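(* Let $\Lambda$ be a sign-respecting function and let $0<\epsilon<1/2$. There exists $\delta_0=\delta_0(\Lambda,\epsilon)>0$ such that for every $0<\delta\le\delta_0$ there is $N=N(\Lambda,\epsilon,\delta)$ such that for all $n\ge N$ the following holds. For every $0\le\eta<1/2$ and every $\mathbf{p}=(p_1,\dots,p_n),\mathbf{p}'=(p_1',\dots,p_n')\in[\epsilon,1-\epsilon]^n$ with $|p_i-p_i'|\ge\epsilon$ for all $i$, if $\bm\beta^*$ is the risk-minimizing linear solution of $(\mathbf{X},Y)$ for $(\mathbf{X},Y,Z)\sim\mathcal{D}^{\eta}_{\mathbf{p},\mathbf{p}'}$, then $$\mathbb{P}_{(\mathbf{X},Y,Z)\sim\mathcal{D}^{\eta}_{\mathbf{p},\mathbf{p}'}}\Big[R^{\Lambda}_{\mathbf{p},\mathbf{p}'}(\mathbf{X},Z)\le\epsilon\ \Big|\ F(H_{\bm\beta^*}(\mathbf{X}))\ge 1-\delta\Big]\ \ge\ 1-\epsilon,$$ where $F$ is the CDF of $H_{\bm\beta^*}(\mathbf{X})$ under $\mathcal{D}^{\eta}_{\mathbf{p},\mathbf{p}'}$ and $$R^{\Lambda}_{\mathbf{p},\mathbf{p}'}(\mathbf{X},Z)=\mathbf{1}_{Z=1}\,F_{1}\big(\Psi^{\Lambda}_{\mathbf{p},\mathbf{p}'}(\mathbf{X})\big)+\mathbf{1}_{Z=-1}\,F_{2}\big(\Psi^{\Lambda}_{\mathbf{p}',\mathbf{p}}(\mathbf{X})\big),$$ with $F_1$ the CDF of $\Psi^{\Lambda}_{\mathbf{p},\mathbf{p}'}(\mathbf{X}')$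 for $\mathbf{X}'\sim\mathcal{B}_{\mathbf{p}}$ and $F_2$ the CDF of $\Psi^{\Lambda}_{\mathbf{p}',\mathbf{p}}(\mathbf{X}')$ for $\mathbf{X}'\sim\mathcal{B}_{\mathbf{p}'}$.
   Context: For $\mathbf{q}\in[0,1]^n$, $\mathcal{B}_{\mathbf{q}}$ is the law of independent $X_i\in\{-1,1\}$ with $\mathbb{P}[X_i=1]=q_i$. The toy distribution $\mathcal{D}^{\eta}_{\mathbf{p},\mathbf{p}'}$: sample $Z$ uniformly from $\{-1,1\}$; if $Z=1$ sample $\mathbf{X}\sim\mathcal{B}_{\mathbf{p}}$, else $\mathbf{X}\sim\mathcal{B}_{\mathbf{p}'}$; set $Y=Z$ with probability $1-\eta$ and $Y=-Z$ with probability $\eta$. The risk-minimizing linear solution is $\bm\beta^*=(\beta_0,\dots,\beta_n)=\arg\min_{\bm\beta}\mathbb{E}(\beta_0+\sum_i\beta_iX_i-Y)^2$ (it is unique under the stated hypotheses). Entropy function: for $\bm\beta\in\mathbb{R}^{n+1}$, $H_{\bm\beta}(x_1,\dots,x_n)=H\big(\frac{e^{s}}{1+e^{s}}\big)$ with $s=\beta_0+\sum_{i=1}^n\beta_ix_i$ and $H(q)=-q\log q-(1-q)\log(1-q)$. A function $\Lambda$ defined on $\{(q,q')\in[0,1]^2: q\ne q'\}$ is sign-respecting if it is continuous on each of $A_+=\{q>q'\}$ and $A_-=\{q<q'\}$, positive on $A_+$ and negative on $A_-$. Spurious cue score: $\Psi^{\Lambda}_{\mathbf{p},\mathbf{p}'}(\mathbf{x})=\sum_{i=1}^n\Lambda(p_i,p_i')x_i$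 (and $\Psi^{\Lambda}_{\mathbf{p}',\mathbf{p}}(\mathbf{x})=\sum_i\Lambda(p_i',p_i)x_i$). For a random variable $V$ with a specified law, its CDF is $F_V(v)=\mathbb{P}[V\le v]$ and $F(V)$ means this CDF evaluated at $V$. *)

theory Defs
  imports "HOL-Analysis.Analysis"
begin

text \<open>Vectors x in {-1,1}^n are functions nat => real on the index set {1..n}
  (extensional: value undefined outside). All laws involved are finite discrete
  laws, so probabilities are written as explicit finite sums.\<close>

definition cube :: "nat \<Rightarrow> (nat \<Rightarrow> real) set" where
  "cube n = PiE {1..n} (\<lambda>_. {-1, 1})"

definition bern :: "nat \<Rightarrow> (nat \<Rightarrow> real) \<Rightarrow> (nat \<Rightarrow> real) \<Rightarrow> real" where
  "bern n q x = (\<Prod>i\<in>{1..n}. if x i = 1 then q i else 1 - q i)"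

definition Dpmf :: "nat \<Rightarrow> real \<Rightarrow> (nat \<Rightarrow> real) \<Rightarrow> (nat \<Rightarrow> real)
    \<Rightarrow> (nat \<Rightarrow> real) \<Rightarrow> real \<Rightarrow> real \<Rightarrow> real" where
  "Dpmf n \<eta> p p' x y z =
     (1/2) * (if z = 1 then bern n p x else bern n p' x) * (if y = z then 1 - \<eta> else \<eta>)"

definition triples :: "nat \<Rightarrow> ((nat \<Rightarrow> real) \<times> real \<times> real) set" where
  "triples n = cube n \<times> {-1, 1} \<times> {-1, 1}"

definition probD :: "nat \<Rightarrow> real \<Rightarrow> (nat \<Rightarrow> real) \<Rightarrow> (nat \<Rightarrow> real)
    \<Rightarrow> ((nat \<Rightarrow> real) \<Rightarrow> real \<Rightarrow> real \<Rightarrow> bool) \<Rightarrow> real" where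
  "probD n \<eta> p p' P = (\<Sum>(x, y, z)\<in>triples n. if P x y z then Dpmf n \<eta> p p' x y z else 0)"

definition risk :: "nat \<Rightarrow> real \<Rightarrow> (nat \<Rightarrow> real) \<Rightarrow> (nat \<Rightarrow> real) \<Rightarrow> (nat \<Rightarrow> real) \<Rightarrow> real" where
  "risk n \<eta> p p' \<beta> = (\<Sum>(x, y, z)\<in>triples n.
      Dpmf n \<eta> p p' x y z * (\<beta> 0 + (\<Sum>i\<in>{1..n}. \<beta> i * x i) - y)\<^sup>2)"

definition is_risk_minimizer :: "nat \<Rightarrow> real \<Rightarrow> (nat \<Rightarrow> real) \<Rightarrow> (nat \<Rightarrow> real) \<Rightarrow> (nat \<Rightarrow> real) \<Rightarrow> bool" where
  "is_risk_minimizer n \<eta> p p' \<beta> \<longleftrightarrow> (\<forall>\<beta>'. risk n \<eta> p p' \<beta> \<le> risk n \<eta> p p' \<beta>')"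

definition Hbin :: "real \<Rightarrow> real" where
  "Hbin q = - q * ln q - (1 - q) * ln (1 - q)"

definition Hbeta :: "nat \<Rightarrow> (nat \<Rightarrow> real) \<Rightarrow> (nat \<Rightarrow> real) \<Rightarrow> real" where
  "Hbeta n \<beta> x = (let s = \<beta> 0 + (\<Sum>i\<in>{1..n}. \<beta> i * x i) in Hbin (exp s / (1 + exp s)))"

definition cdfH :: "nat \<Rightarrow> real \<Rightarrow> (nat \<Rightarrow> real) \<Rightarrow> (nat \<Rightarrow> real) \<Rightarrow> (nat \<Rightarrow> real) \<Rightarrow> real \<Rightarrow> real" where
  "cdfH n \<eta> p p' \<beta> v = probD n \<eta> p p' (\<lambda>x y z. Hbeta n \<beta> x \<le> v)"

definition sign_respecting :: "(real \<Rightarrow> real \<Rightarrow> real) \<Rightarrow> bool" where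
  "sign_respecting \<Lambda> \<longleftrightarrow>
     continuous_on {(q, q'). q \<in> {0..1} \<and> q' \<in> {0..1} \<and> q > q'} (\<lambda>(q, q'). \<Lambda> q q') \<and>
     continuous_on {(q, q'). q \<in> {0..1} \<and> q' \<in> {0..1} \<and> q < q'} (\<lambda>(q, q'). \<Lambda> q q') \<and>
     (\<forall>q\<in>{0..1}. \<forall>q'\<in>{0..1}. q > q' \<longrightarrow> \<Lambda> q q' > 0) \<and>
     (\<forall>q\<in>{0..1}. \<forall>q'\<in>{0..1}. q < q' \<longrightarrow> \<Lambda> q q' < 0)"

definition Psi :: "(real \<Rightarrow> real \<Rightarrow> real) \<Rightarrow> nat \<Rightarrow> (nat \<Rightarrow> real) \<Rightarrow> (nat \<Rightarrow> real) \<Rightarrow> (nat \<Rightarrow> real) \<Rightarrow> real" where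
  "Psi \<Lambda> n p p' x = (\<Sum>i\<in>{1..n}. \<Lambda> (p i) (p' i) * x i)"

definition cdfB :: "nat \<Rightarrow> (nat \<Rightarrow> real) \<Rightarrow> ((nat \<Rightarrow> real) \<Rightarrow> real) \<Rightarrow> real \<Rightarrow> real" where
  "cdfB n q g v = (\<Sum>x\<in>cube n. if g x \<le> v then bern n q x else 0)"

definition Rscore :: "(real \<Rightarrow> real \<Rightarrow> real) \<Rightarrow> nat \<Rightarrow> (nat \<Rightarrow> real) \<Rightarrow> (nat \<Rightarrow> real)
    \<Rightarrow> (nat \<Rightarrow> real) \<Rightarrow> real \<Rightarrow> real" where
  "Rscore \<Lambda> n p p' x z =
     (if z = 1 then cdfB n p (Psi \<Lambda> n p p') (Psi \<Lambda> n p p' x) else 0) +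
     (if z = -1 then cdfB n p' (Psi \<Lambda> n p' p) (Psi \<Lambda> n p' p x) else 0)"

end

theory Submission
  imports Defs
begin

text \<open>
  The normal equations show that the risk minimizer is a positive multiple of
  \<open>T x = (\<Sum>i. d\<^sub>i / v\<^sub>i * (x\<^sub>i - m\<^sub>i))\<close> with \<open>d = p - p'\<close>, \<open>m = p + p' - 1\<close> and
  \<open>v = 2 p (1 - p) + 2 p' (1 - p')\<close>; given \<open>Z = 1\<close> or \<open>Z = -1\<close>, \<open>T\<close> has mean \<open>S\<close> or \<open>-S\<close>, where
  \<open>S = (\<Sum>i. d\<^sub>i\<^sup>2 / v\<^sub>i)\<close> is of order \<open>n\<close>. The entropy is a strictly decreasing function of \<open>\<bar>T\<bar>\<close>, so
  high entropy means \<open>\<bar>T\<bar> \<le> t\<close> with \<open>t = S - K \<surd>n\<close>; here \<open>K\<close> is bounded for fixed \<open>\<delta>\<close>, and large if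
  \<open>\<delta>\<close> is small. Given \<open>Z = 1\<close>, such a point lies \<open>K \<surd>n\<close> below the mean of \<open>T\<close>, while a spurious cue
  score that is not in its lower \<open>\<epsilon>\<close>-tail is, by Chebyshev, at most \<open>K' \<surd>n\<close> below its own mean. As the
  two sums are positively correlated, the joint event has probability at most
  \<open>exp (- K\<^sup>2 / (2 V) - \<rho> K\<^sup>2 + O(1))\<close> by a two-parameter Chernoff bound, where \<open>V\<close> is the
  variance of \<open>T\<close> divided by \<open>n\<close>. Exponential tilting bounds the probability of \<open>\<bar>T\<bar> \<le> t\<close> from
  below by \<open>exp (- K\<^sup>2 / (2 V) - O(K))\<close>, which is much larger once \<open>K\<close> is large. No central
  limit theorem is needed. The case \<open>Z = -1\<close> follows by exchanging \<open>p\<close> and \<open>p'\<close>.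
\<close>

section \<open>Finite product laws on the cube\<close>

definition bexp :: "nat \<Rightarrow> (nat \<Rightarrow> real) \<Rightarrow> ((nat \<Rightarrow> real) \<Rightarrow> real) \<Rightarrow> real" where
  "bexp n q f = (\<Sum>x\<in>cube n. bern n q x * f x)"

definition bprob :: "nat \<Rightarrow> (nat \<Rightarrow> real) \<Rightarrow> ((nat \<Rightarrow> real) \<Rightarrow> bool) \<Rightarrow> real" where
  "bprob n q P = (\<Sum>x\<in>cube n. if P x then bern n q x else 0)"

text \<open>Under \<open>bern n q\<close> the coordinate \<open>x i\<close> has mean
  \<open>2 * q i - 1\<close>, so this is a linear form minus its expectation.\<close>

definition centered_sum :: "nat \<Rightarrow> (nat \<Rightarrow> real) \<Rightarrow> (nat \<Rightarrow> real) \<Rightarrow> (nat \<Rightarrow> real) \<Rightarrow> real" where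
  "centered_sum n q a x = (\<Sum>i\<in>{1..n}. a i * (x i - (2 * q i - 1)))"

lemma finite_cube [simp]: "finite (cube n)"
  by (simp add: cube_def finite_PiE)

lemma cube_cases: "x \<in> cube n \<Longrightarrow> i \<in> {1..n} \<Longrightarrow> x i = 1 \<or> x i = -1"
  by (auto simp: cube_def PiE_def Pi_def)

lemma bern_nonneg: "(\<And>i. i \<in> {1..n} \<Longrightarrow> 0 \<le> q i \<and> q i \<le> 1) \<Longrightarrow> 0 \<le> bern n q x"
  unfolding bern_def by (intro prod_nonneg) (auto simp: Ball_def)

text \<open>Independence: expanding the product of two-term sums yields exactly one term for each
  point of the cube. Total mass one and the one- and two-coordinate marginals are the instances in
  which most factors are constantly 1.\<close>

lemma bexp_prod:
  "bexp n q (\<lambda>x. \<Prod>i\<in>{1..n}. f i (x i)) = (\<Prod>i\<in>{1..n}. q i * f i 1 + (1 - q i) * f i (-1))"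
proof -
  have "(\<Prod>i\<in>{1..n}. q i * f i 1 + (1 - q i) * f i (-1)) =
     (\<Prod>i\<in>{1..n}. \<Sum>y\<in>{-1,1}. (if y = 1 then q i else 1 - q i) * f i y)"
    by (intro prod.cong) auto
  also have "\<dots> = (\<Sum>x\<in>cube n. \<Prod>i\<in>{1..n}. (if x i = 1 then q i else 1 - q i) * f i (x i))"
    unfolding cube_def by (rule prod_sum_PiE) auto
  also have "\<dots> = bexp n q (\<lambda>x. \<Prod>i\<in>{1..n}. f i (x i))"
    by (simp add: bexp_def bern_def prod.distrib)
  finally show ?thesis by simp
qed

lemma bexp_1 [simp]: "bexp n q (\<lambda>x. 1) = 1"
  using bexp_prod[of n q "\<lambda>_ _. 1"] by simp

lemma bexp_const [simp]: "bexp n q (\<lambda>x. c) = c"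
  using bexp_1[of n q, unfolded bexp_def] by (simp add: bexp_def flip: sum_distrib_right)

lemma bexp_add: "bexp n q (\<lambda>x. f x + g x) = bexp n q f + bexp n q g"
  by (simp add: bexp_def algebra_simps sum.distrib)

lemma bexp_cmult: "bexp n q (\<lambda>x. c * f x) = c * bexp n q f"
  by (simp add: bexp_def sum_distrib_left mult_ac)

lemma bexp_sum: "bexp n q (\<lambda>x. \<Sum>i\<in>I. f i x) = (\<Sum>i\<in>I. bexp n q (f i))"
  by (simp add: bexp_def sum_distrib_left sum.swap[of _ I])

lemma bexp_mono:
  assumes "\<And>i. i \<in> {1..n} \<Longrightarrow> 0 \<le> q i \<and> q i \<le> 1" "\<And>x. x \<in> cube n \<Longrightarrow> f x \<le> g x"
  shows "bexp n q f \<le> bexp n q g"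
  unfolding bexp_def using assms by (intro sum_mono mult_left_mono bern_nonneg) auto

lemma bexp_coord:
  assumes "j \<in> {1..n}"
  shows "bexp n q (\<lambda>x. u (x j)) = q j * u 1 + (1 - q j) * u (-1)"
proof -
  have "bexp n q (\<lambda>x. u (x j)) = bexp n q (\<lambda>x. \<Prod>i\<in>{1..n}. if i = j then u (x i) else 1)"
    using assms by simp
  also have "\<dots> = (\<Prod>i\<in>{1..n}. q i * (if i = j then u 1 else 1) + (1 - q i) * (if i = j then u (-1) else 1))"
    by (rule bexp_prod)
  also have "\<dots> = (\<Prod>i\<in>{1..n}. if i = j then q j * u 1 + (1 - q j) * u (-1) else 1)"
    by (intro prod.cong) auto
  finally show ?thesis using assms by simp
qed

lemma bexp_coord_pair:
  assumes "j \<in> {1..n}" "k \<in> {1..n}" "j \<noteq> k"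
  shows "bexp n q (\<lambda>x. u (x j) * w (x k)) =
    (q j * u 1 + (1 - q j) * u (-1)) * (q k * w 1 + (1 - q k) * w (-1))"
proof -
  have pr: "(\<Prod>i\<in>{1..n}. (if i = j then a else 1) * (if i = k then b else 1)) = a * b" for a b :: real
    using assms by (simp add: prod.distrib)
  have eq: "(\<Prod>i\<in>{1..n}. (if i = j then u (x i) else 1) * (if i = k then w (x i) else 1))
       = u (x j) * w (x k)" for x
    using assms by (simp add: prod.distrib)
  have "bexp n q (\<lambda>x. u (x j) * w (x k)) =
     bexp n q (\<lambda>x. \<Prod>i\<in>{1..n}. (if i = j then u (x i) else 1) * (if i = k then w (x i) else 1))"
    by (simp only: eq)
  also have "\<dots> = (\<Prod>i\<in>{1..n}. q i * ((if i = j then u 1 else 1) * (if i = k then w 1 else 1))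
      + (1 - q i) * ((if i = j then u (-1) else 1) * (if i = k then w (-1) else 1)))"
    by (rule bexp_prod)
  also have "\<dots> = (\<Prod>i\<in>{1..n}. (if i = j then q j * u 1 + (1 - q j) * u (-1) else 1)
        * (if i = k then q k * w 1 + (1 - q k) * w (-1) else 1))"
    using assms by (intro prod.cong) auto
  finally show ?thesis by (simp only: pr)
qed

text \<open>Off-diagonal terms vanish because independent centered coordinates have mean zero; the
  diagonal contributes \<open>4 * q i * (1 - q i)\<close>, the variance of a sign with bias
  \<open>q i\<close>.\<close>

lemma bexp_centered_sum_sq:
  "bexp n q (\<lambda>x. (centered_sum n q a x)\<^sup>2) = (\<Sum>i\<in>{1..n}. (a i)\<^sup>2 * (4 * q i * (1 - q i)))"
proof -
  have 1: "bexp n q (\<lambda>x. a i * (x i - (2 * q i - 1)) * (a j * (x j - (2 * q j - 1)))) =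
     (if i = j then (a i)\<^sup>2 * (4 * q i * (1 - q i)) else 0)"
    if "i \<in> {1..n}" "j \<in> {1..n}" for i j
  proof (cases "i = j")
    case True
    then show ?thesis
      using bexp_coord[OF that(1), of q "\<lambda>t. a i * (t - (2 * q i - 1)) * (a i * (t - (2 * q i - 1)))"]
      by (simp add: power2_eq_square algebra_simps)
  next
    case False
    then show ?thesis
      using bexp_coord_pair[OF that False, of q "\<lambda>t. a i * (t - (2 * q i - 1))" "\<lambda>t. a j * (t - (2 * q j - 1))"]
      by simp
  qed
  have "bexp n q (\<lambda>x. (centered_sum n q a x)\<^sup>2) =
     (\<Sum>i\<in>{1..n}. \<Sum>j\<in>{1..n}. bexp n q (\<lambda>x. a i * (x i - (2 * q i - 1)) * (a j * (x j - (2 * q j - 1)))))"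
    unfolding centered_sum_def power2_eq_square sum_product bexp_sum by simp
  also have "\<dots> = (\<Sum>i\<in>{1..n}. \<Sum>j\<in>{1..n}. (if i = j then (a i)\<^sup>2 * (4 * q i * (1 - q i)) else 0))"
    using 1 by (intro sum.cong) auto
  finally show ?thesis by simp
qed

section \<open>Probabilities of events and Chebyshev's inequality\<close>

lemma bprob_eq_bexp: "bprob n q P = bexp n q (\<lambda>x. if P x then 1 else 0)"
  by (simp add: bprob_def bexp_def if_distrib cong: if_cong)

lemma bprob_mono:
  assumes "\<And>i. i \<in> {1..n} \<Longrightarrow> 0 \<le> q i \<and> q i \<le> 1" "\<And>x. x \<in> cube n \<Longrightarrow> P x \<Longrightarrow> Q x"
  shows "bprob n q P \<le> bprob n q Q"
  unfolding bprob_def using assms by (intro sum_mono) (auto intro!: bern_nonneg)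

lemma bprob_not: "bprob n q (\<lambda>x. \<not> P x) = 1 - bprob n q P"
proof -
  have "bprob n q P + bprob n q (\<lambda>x. \<not> P x) = bexp n q (\<lambda>x. 1)"
    unfolding bprob_eq_bexp bexp_add[symmetric] by (rule arg_cong[where f="bexp n q"]) auto
  then show ?thesis by simp
qed

lemma bprob_split: "bprob n q P = bprob n q (\<lambda>x. P x \<and> Q x) + bprob n q (\<lambda>x. P x \<and> \<not> Q x)"
  unfolding bprob_def sum.distrib[symmetric] by (intro sum.cong) auto

lemma chebyshev_centered_sum:
  assumes q: "\<And>i. i \<in> {1..n} \<Longrightarrow> 0 \<le> q i \<and> q i \<le> 1"
    and a: "\<And>i. i \<in> {1..n} \<Longrightarrow> \<bar>a i\<bar> \<le> M" and r: "r > 0"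
  shows "bprob n q (\<lambda>x. \<bar>centered_sum n q a x\<bar> \<ge> r) \<le> M\<^sup>2 * real n / r\<^sup>2"
proof -
  have "bprob n q (\<lambda>x. \<bar>centered_sum n q a x\<bar> \<ge> r) \<le> bexp n q (\<lambda>x. 1 / r\<^sup>2 * (centered_sum n q a x)\<^sup>2)"
    unfolding bprob_eq_bexp
  proof (rule bexp_mono[OF q])
    fix x assume "x \<in> cube n"
    have "r\<^sup>2 \<le> (centered_sum n q a x)\<^sup>2" if "r \<le> \<bar>centered_sum n q a x\<bar>"
      using that r by (metis abs_le_square_iff abs_of_pos)
    then show "(if r \<le> \<bar>centered_sum n q a x\<bar> then 1 else 0) \<le> 1 / r\<^sup>2 * (centered_sum n q a x)\<^sup>2"
      using r by (auto simp: field_simps)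
  qed
  also have "\<dots> = 1 / r\<^sup>2 * (\<Sum>i\<in>{1..n}. (a i)\<^sup>2 * (4 * q i * (1 - q i)))"
    by (simp only: bexp_cmult bexp_centered_sum_sq)
  also have "\<dots> \<le> 1 / r\<^sup>2 * (\<Sum>i\<in>{1..n}. M\<^sup>2 * 1)"
  proof (intro mult_left_mono sum_mono mult_mono)
    fix i assume i: "i \<in> {1..n}"
    show "(a i)\<^sup>2 \<le> M\<^sup>2" using a[OF i] by (metis abs_ge_zero abs_le_square_iff abs_of_nonneg order_trans)
    show "4 * q i * (1 - q i) \<le> 1" using zero_le_power2[of "2 * q i - 1"]
      by (simp add: power2_eq_square algebra_simps)
    show "0 \<le> 4 * q i * (1 - q i)" using q[OF i] by simp
  qed auto
  finally show ?thesis by (simp add: field_simps)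
qed

section \<open>Moment generating functions and tilting\<close>

text \<open>The moment generating function of the centered sign, whose two values are
  \<open>2 * (1 - q)\<close> and \<open>- 2 * q\<close>.\<close>

definition mgf :: "real \<Rightarrow> real \<Rightarrow> real" where
  "mgf q h = q * exp (2 * (1 - q) * h) + (1 - q) * exp (- (2 * q * h))"

text \<open>The probability of the value 1 after the law is reweighted by the exponential with
  parameter \<open>h\<close> and normalized.\<close>

definition tilt :: "real \<Rightarrow> real \<Rightarrow> real" where
  "tilt q h = q * exp (2 * (1 - q) * h) / mgf q h"

lemma mgf_ge_1: "0 \<le> q \<Longrightarrow> q \<le> 1 \<Longrightarrow> 1 \<le> mgf q h"
proof -
  assume q: "0 \<le> q" "q \<le> 1"
  have "q * (1 + 2 * (1 - q) * h) + (1 - q) * (1 + - (2 * q * h)) \<le> mgf q h"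
    unfolding mgf_def using q by (intro add_mono mult_left_mono exp_ge_add_one_self) auto
  then show ?thesis by (simp add: algebra_simps)
qed

lemma exp_taylor2: "\<bar>x\<bar> \<le> 1 \<Longrightarrow> \<bar>exp x - 1 - x\<bar> \<le> 3/2 * x\<^sup>2" for x :: real
proof -
  assume x: "\<bar>x\<bar> \<le> 1"
  obtain t where t: "\<bar>t\<bar> \<le> \<bar>x\<bar>" "exp x = (\<Sum>m<2. x ^ m / fact m) + exp t / fact 2 * x ^ 2"
    using Maclaurin_exp_le[of x 2] by auto
  have "exp t \<le> exp 1" using t x by simp
  then have "exp t \<le> 3" using exp_le by linarith
  then have "exp t / 2 * x\<^sup>2 \<le> 3/2 * x\<^sup>2" by (intro mult_right_mono) auto
  then show ?thesis using t(2) by (simp add: eval_nat_numeral)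
qed

lemma exp_taylor3: "\<bar>x\<bar> \<le> 1 \<Longrightarrow> \<bar>exp x - 1 - x - x\<^sup>2 / 2\<bar> \<le> \<bar>x\<bar> ^ 3" for x :: real
proof -
  assume x: "\<bar>x\<bar> \<le> 1"
  obtain t where t: "\<bar>t\<bar> \<le> \<bar>x\<bar>" "exp x = (\<Sum>m<3. x ^ m / fact m) + exp t / fact 3 * x ^ 3"
    using Maclaurin_exp_le[of x 3] by auto
  have "exp t \<le> exp 1" using t x by simp
  then have "exp t \<le> 3" using exp_le by linarith
  then have "exp t / 6 * \<bar>x\<bar> ^ 3 \<le> 1 * \<bar>x\<bar> ^ 3" by (intro mult_right_mono) auto
  moreover have "exp x - 1 - x - x\<^sup>2 / 2 = exp t / 6 * x ^ 3"
    using t(2) by (simp add: eval_nat_numeral)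
  moreover have "\<bar>exp t / 6 * x ^ 3\<bar> = exp t / 6 * \<bar>x\<bar> ^ 3" by (simp add: abs_mult power_abs)
  ultimately show ?thesis by simp
qed

text \<open>Second-order expansion at 0. Both exponents are at most \<open>2 * \<bar>h\<bar>\<close>
  in absolute value, so each cubic remainder is at most
  \<open>8 * \<bar>h\<bar> ^ 3\<close>.\<close>

lemma mgf_bound:
  assumes q: "0 \<le> q" "q \<le> 1" and h: "\<bar>h\<bar> \<le> 1/2"
  shows "\<bar>mgf q h - 1 - h\<^sup>2 * (4 * q * (1 - q)) / 2\<bar> \<le> 8 * \<bar>h\<bar> ^ 3"
proof -
  define a b where "a = 2 * (1 - q) * h" and "b = - (2 * q * h)"
  have a: "\<bar>a\<bar> \<le> 2 * \<bar>h\<bar>" and b: "\<bar>b\<bar> \<le> 2 * \<bar>h\<bar>"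
    using q by (auto simp: a_def b_def abs_mult intro!: mult_right_mono mult_left_le_one_le)
  have ea: "\<bar>exp a - 1 - a - a\<^sup>2 / 2\<bar> \<le> 8 * \<bar>h\<bar> ^ 3"
    using exp_taylor3[of a] a h power_mono[OF a, of 3] by (simp add: power_mult_distrib)
  have eb: "\<bar>exp b - 1 - b - b\<^sup>2 / 2\<bar> \<le> 8 * \<bar>h\<bar> ^ 3"
    using exp_taylor3[of b] b h power_mono[OF b, of 3] by (simp add: power_mult_distrib)
  \<comment> \<open>The linear terms cancel since \<open>q * a + (1 - q) * b = 0\<close>, and the
    squares average to the variance times \<open>h\<^sup>2\<close>.\<close>
  have "mgf q h - 1 - h\<^sup>2 * (4 * q * (1 - q)) / 2 =
     q * (exp a - 1 - a - a\<^sup>2 / 2) + (1 - q) * (exp b - 1 - b - b\<^sup>2 / 2)"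
    unfolding mgf_def a_def[symmetric] b_def[symmetric]
    unfolding a_def b_def by (simp add: power2_eq_square field_simps)
  also have "\<bar>\<dots>\<bar> \<le> q * (8 * \<bar>h\<bar> ^ 3) + (1 - q) * (8 * \<bar>h\<bar> ^ 3)"
    using q ea eb by (intro order_trans[OF abs_triangle_ineq] add_mono) (auto simp: abs_mult intro!: mult_left_mono)
  finally show ?thesis by (simp add: algebra_simps)
qed

lemma mgf_upper:
  assumes "0 \<le> q" "q \<le> 1" "\<bar>h\<bar> \<le> 1/2"
  shows "mgf q h \<le> exp (h\<^sup>2 * (4 * q * (1 - q)) / 2 + 9 * \<bar>h\<bar> ^ 3)"
proof -
  have "mgf q h \<le> 1 + (h\<^sup>2 * (4 * q * (1 - q)) / 2 + 9 * \<bar>h\<bar> ^ 3)"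
    using mgf_bound[OF assms] zero_le_power[of "\<bar>h\<bar>" 3] by linarith
  then show ?thesis using exp_ge_add_one_self order_trans by blast
qed

lemma var_le_1: "4 * q * (1 - q) \<le> (1 :: real)"
  using zero_le_power2[of "2 * q - 1"] by (simp add: power2_eq_square algebra_simps)

text \<open>A nonpositive exponent is covered by \<open>mgf_ge_1\<close>. Otherwise the exponent
  \<open>y\<close> is at most \<open>h\<^sup>2 / 2\<close>, so the quadratic error of
  \<open>exp y\<close> is at most \<open>3/8 * \<bar>h\<bar> ^ 3\<close>, which fits in the gap
  between the constants 8 and 9.\<close>

lemma mgf_lower:
  assumes q: "0 \<le> q" "q \<le> 1" and h: "\<bar>h\<bar> \<le> 1/8"
  shows "exp (h\<^sup>2 * (4 * q * (1 - q)) / 2 - 9 * \<bar>h\<bar> ^ 3) \<le> mgf q h"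
proof (cases "h\<^sup>2 * (4 * q * (1 - q)) / 2 - 9 * \<bar>h\<bar> ^ 3 \<le> 0")
  case True
  then show ?thesis using mgf_ge_1[OF q, of h] by (meson exp_le_one_iff order_trans)
next
  case False
  define y where "y = h\<^sup>2 * (4 * q * (1 - q)) / 2 - 9 * \<bar>h\<bar> ^ 3"
  have "h\<^sup>2 * (4 * q * (1 - q)) \<le> h\<^sup>2 * 1" by (intro mult_left_mono var_le_1) auto
  then have y: "0 < y" "y \<le> h\<^sup>2 / 2"
    using False zero_le_power[of "\<bar>h\<bar>" 3] unfolding y_def by linarith+
  have h2: "h\<^sup>2 \<le> \<bar>h\<bar>" using h mult_right_mono[of "\<bar>h\<bar>" 1 "\<bar>h\<bar>"] by (simp add: power2_eq_square flip: abs_mult)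
  have "exp y \<le> 1 + y + 3/2 * y\<^sup>2" using exp_taylor2[of y] y h h2 by linarith
  moreover have "y\<^sup>2 \<le> \<bar>h\<bar> ^ 3 / 4"
  proof -
    have "y\<^sup>2 \<le> (h\<^sup>2 / 2)\<^sup>2" using y by (intro power_mono) auto
    also have "\<dots> = \<bar>h\<bar> * \<bar>h\<bar> ^ 3 / 4" by (simp add: power_divide eval_nat_numeral flip: abs_mult) 
    also have "\<dots> \<le> 1 * \<bar>h\<bar> ^ 3 / 4" using h by (intro divide_right_mono mult_right_mono) auto
    finally show ?thesis by simp
  qed
  ultimately show ?thesis using mgf_bound[of q h] q h zero_le_power[of "\<bar>h\<bar>" 3]
    unfolding y_def[symmetric] by (simp add: y_def)
qed

lemma tilt_bounds:
  assumes "0 \<le> q" "q \<le> 1"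
  shows "0 \<le> tilt q h" "tilt q h \<le> 1"
  using assms mgf_ge_1[OF assms, of h] by (auto simp: tilt_def divide_le_eq_1 mgf_def)

text \<open>The derivative of the tilted probability at 0 is \<open>2 * q * (1 - q)\<close>; hence
  the mean of the sign moves by its variance times \<open>h\<close>, up to order
  \<open>h\<^sup>2\<close>.\<close>

lemma tilt_approx:
  assumes q: "0 \<le> q" "q \<le> 1" and h: "\<bar>h\<bar> \<le> 1/8"
  shows "\<bar>tilt q h - q - 2 * q * (1 - q) * h\<bar> \<le> 18 * h\<^sup>2"
proof -
  define a r s where "a = 2 * (1 - q) * h" and "r = exp a - 1 - a" and "s = mgf q h - 1"
  have a: "\<bar>a\<bar> \<le> 2 * \<bar>h\<bar>"
    using q by (auto simp: a_def abs_mult intro!: mult_right_mono)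
  have r: "\<bar>r\<bar> \<le> 6 * h\<^sup>2"
    using exp_taylor2[of a] a h power_mono[OF a, of 2] by (simp add: r_def power_mult_distrib)
  have "\<bar>h\<bar> ^ 3 = h\<^sup>2 * \<bar>h\<bar>" by (simp add: eval_nat_numeral flip: abs_mult)
  also have "\<dots> \<le> h\<^sup>2 * (1/8)" using h by (intro mult_left_mono) auto
  finally have h3: "\<bar>h\<bar> ^ 3 \<le> h\<^sup>2 / 8" by simp
  have "h\<^sup>2 * (4 * q * (1 - q)) \<le> h\<^sup>2 * 1" by (intro mult_left_mono var_le_1) auto
  then have s: "\<bar>s\<bar> \<le> 6 * h\<^sup>2" using mgf_bound[of q h] q h h3 mgf_ge_1[of q h] unfolding s_def by linarith
  have M: "mgf q h \<ge> 1" using mgf_ge_1 q by simp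
  \<comment> \<open>Since \<open>q + 2 * q * (1 - q) * h = q * (1 + a)\<close>, clearing the
    denominator leaves only the remainders \<open>r\<close> and \<open>s\<close>, both of order
    \<open>h\<^sup>2\<close>; dividing by \<open>mgf q h\<close>, which is at least 1, does not
    increase them.\<close>
  have "tilt q h - q - 2 * q * (1 - q) * h = (q * r - s * (q * (1 + a))) / mgf q h"
  proof -
    have "(tilt q h - q - 2 * q * (1 - q) * h) * mgf q h = q * exp a - mgf q h * (q * (1 + a))"
      using M by (simp add: tilt_def a_def algebra_simps)
    also have "\<dots> = q * r - s * (q * (1 + a))" by (simp add: r_def s_def algebra_simps)
    finally show ?thesis using M by (simp add: field_simps)
  qed
  also have "\<bar>\<dots>\<bar> \<le> \<bar>q * r - s * (q * (1 + a))\<bar>" using M by (simp add: divide_le_eq mult_le_cancel_left1)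
  also have "\<dots> \<le> 1 * (6 * h\<^sup>2) + 6 * h\<^sup>2 * (1 * 2)"
  proof -
    have "\<bar>q * r\<bar> \<le> 1 * (6 * h\<^sup>2)" unfolding abs_mult using q r by (intro mult_mono) auto
    moreover have "\<bar>s * (q * (1 + a))\<bar> \<le> 6 * h\<^sup>2 * (1 * 2)" 
      unfolding abs_mult using q s a h by (intro mult_mono) auto
    ultimately show ?thesis by linarith
  qed
  finally show ?thesis by simp
qed

text \<open>Change of measure, checked coordinate by coordinate: exponential reweighting of a
  product law gives another product law times a normalizing constant.\<close>

lemma bern_tilt:
  assumes q: "\<And>i. i \<in> {1..n} \<Longrightarrow> 0 \<le> q i \<and> q i \<le> 1" and x: "x \<in> cube n"
  shows "bern n q x * exp (centered_sum n q h x) =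
    bern n (\<lambda>i. tilt (q i) (h i)) x * (\<Prod>i\<in>{1..n}. mgf (q i) (h i))"
proof -
  have "(if x i = 1 then q i else 1 - q i) * exp (h i * (x i - (2 * q i - 1))) =
     (if x i = 1 then tilt (q i) (h i) else 1 - tilt (q i) (h i)) * mgf (q i) (h i)"
    if i: "i \<in> {1..n}" for i
  proof -
    have M: "mgf (q i) (h i) \<ge> 1" using mgf_ge_1 q[OF i] by simp
    have 1: "tilt (q i) (h i) * mgf (q i) (h i) = q i * exp (2 * (1 - q i) * h i)"
      using M by (simp add: tilt_def)
    have "(1 - tilt (q i) (h i)) * mgf (q i) (h i) = mgf (q i) (h i) - q i * exp (2 * (1 - q i) * h i)"
      using 1 by (simp add: algebra_simps)
    also have "\<dots> = (1 - q i) * exp (- (2 * q i * h i))" by (simp add: mgf_def)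
    finally have 2: "(1 - tilt (q i) (h i)) * mgf (q i) (h i) = (1 - q i) * exp (- (2 * q i * h i))" .
    show ?thesis using cube_cases[OF x i] 1 2 by (auto simp: algebra_simps)
  qed
  then show ?thesis
    by (simp add: bern_def centered_sum_def exp_sum flip: prod.distrib)
qed

text \<open>Summing \<open>bern_tilt\<close> over the cube leaves the constant, because the tilted
  law has total mass one.\<close>

lemma bexp_exp_centered_sum:
  assumes q: "\<And>i. i \<in> {1..n} \<Longrightarrow> 0 \<le> q i \<and> q i \<le> 1"
  shows "bexp n q (\<lambda>x. exp (centered_sum n q h x)) = (\<Prod>i\<in>{1..n}. mgf (q i) (h i))"
proof -
  have "bexp n q (\<lambda>x. exp (centered_sum n q h x)) =
     bexp n (\<lambda>i. tilt (q i) (h i)) (\<lambda>x. \<Prod>i\<in>{1..n}. mgf (q i) (h i))"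
    unfolding bexp_def using bern_tilt[OF q] by (intro sum.cong) auto
  then show ?thesis by simp
qed

section \<open>Two-sided tail estimates\<close>

text \<open>The added constant is the mean of the form under \<open>bern n r\<close>; with
  \<open>r\<close> the tilted parameters it measures how far tilting moves the mean.\<close>

lemma centered_sum_shift:
  "centered_sum n q a x = centered_sum n r a x + (\<Sum>i\<in>{1..n}. 2 * a i * (r i - q i))"
  unfolding centered_sum_def sum.distrib[symmetric] by (intro sum.cong) (auto simp: algebra_simps)

lemma centered_sum_scale: "centered_sum n q (\<lambda>i. c * a i) x = c * centered_sum n q a x"
  unfolding centered_sum_def sum_distrib_left by (intro sum.cong) auto

lemma centered_sum_add:
  "centered_sum n q (\<lambda>i. a i + b i) x = centered_sum n q a x + centered_sum n q b x"
  unfolding centered_sum_def sum.distrib[symmetric] by (intro sum.cong) (auto simp: algebra_simps)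

text \<open>Exponential tilting with parameter \<open>\<theta> = (K + 3 M) / V\<close> moves the mean of the sum to about
  \<open>-(K + 3 M) \<surd>n\<close>; under the tilted product law Chebyshev's inequality suffices.\<close>

lemma lower_tail:
  assumes q: "\<And>i. i \<in> {1..n} \<Longrightarrow> 0 \<le> q i \<and> q i \<le> 1"
    and a: "\<And>i. i \<in> {1..n} \<Longrightarrow> \<bar>a i\<bar> \<le> M" and M: "M > 0" and n: "n > 0"
    and V: "V = (\<Sum>i\<in>{1..n}. (a i)\<^sup>2 * (4 * q i * (1 - q i))) / real n" "v0 \<le> V" and v0: "v0 > 0"
    and K: "0 \<le> K" "K \<le> K1" and L: "L = (K1 + 3 * M) / v0"
    and n1: "8 * (L * M) \<le> sqrt n" "9 * (L * M) ^ 3 \<le> sqrt n" "36 * (L * M)\<^sup>2 \<le> sqrt n"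
  shows "3/4 * exp (- 1 - (K + 9 * M)\<^sup>2 / (2 * V)) \<le>
    bprob n q (\<lambda>x. - (K + 6 * M) * sqrt n \<le> centered_sum n q a x \<and> centered_sum n q a x \<le> - K * sqrt n)"
proof -
  define \<theta> where "\<theta> = (K + 3 * M) / V"
  define h where "h = (\<lambda>i. - \<theta> / sqrt n * a i)"
  define r where "r = (\<lambda>i. tilt (q i) (h i))"
  define W where "W = centered_sum n q a"
  define good where "good = (\<lambda>x. - (K + 6 * M) * sqrt n \<le> W x \<and> W x \<le> - K * sqrt n)"
  define \<mu> where "\<mu> = (\<Sum>i\<in>{1..n}. 2 * a i * (r i - q i))"
  have sn: "sqrt n > 0" and snn: "sqrt n * sqrt n = n" using n by auto
  have Vpos: "V > 0" using V v0 by simp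
  have th: "0 \<le> \<theta>" "\<theta> \<le> L" using K M V(2) v0 Vpos unfolding \<theta>_def L
    by (auto intro!: frac_le)
  have hb: "\<bar>h i\<bar> \<le> L * M / sqrt n" if "i \<in> {1..n}" for i
    unfolding h_def using th a[OF that] sn M by (auto simp: abs_mult field_simps intro!: mult_mono)
  have LM: "L * M / sqrt n \<le> 1/8" using n1(1) sn by (simp add: field_simps)
  have LM0: "0 \<le> L * M" using th M by auto
  have h8: "\<bar>h i\<bar> \<le> 1/8" if "i \<in> {1..n}" for i using hb[OF that] LM by linarith
  have h2: "(h i)\<^sup>2 \<le> (L * M)\<^sup>2 / n" if "i \<in> {1..n}" for i
  proof -
    have "\<bar>h i\<bar>\<^sup>2 \<le> (L * M / sqrt n)\<^sup>2" using hb[OF that] by (intro power_mono) auto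
    then show ?thesis using n by (simp add: power_divide)
  qed
  \<comment> \<open>The cubic errors of all \<open>n\<close> factors add up to order
    \<open>1 / sqrt n\<close>; the bound 1 becomes the \<open>- 1\<close> in the final
    exponent.\<close>
  have h3: "(\<Sum>i\<in>{1..n}. 9 * \<bar>h i\<bar> ^ 3) \<le> 1"
  proof -
    have "(\<Sum>i\<in>{1..n}. 9 * \<bar>h i\<bar> ^ 3) \<le> (\<Sum>i\<in>{1..n}. 9 * (L * M / sqrt n) ^ 3)"
      using hb by (intro sum_mono mult_left_mono power_mono) auto
    also have "\<dots> = 9 * (L * M) ^ 3 / sqrt n"
      using sn snn by (simp add: power_divide eval_nat_numeral)
    also have "\<dots> \<le> 1" using n1(2) sn by simp
    finally show ?thesis .
  qed
  have r01: "\<And>i. i \<in> {1..n} \<Longrightarrow> 0 \<le> r i \<and> r i \<le> 1"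
    unfolding r_def using tilt_bounds q by auto
  \<comment> \<open>The first-order shifts add up to \<open>- \<theta> * V * sqrt n\<close>, which
    the choice of \<open>\<theta>\<close> makes \<open>- (K + 3 * M) * sqrt n\<close>; the errors of
    \<open>tilt_approx\<close> total at most \<open>M * sqrt n\<close>.\<close>
  have mu: "\<bar>\<mu> + (K + 3 * M) * sqrt n\<bar> \<le> M * sqrt n"
  proof -
    have "(\<Sum>i\<in>{1..n}. 2 * a i * (2 * q i * (1 - q i) * h i)) = - \<theta> / sqrt n * (V * n)"
    proof -
      have "(\<Sum>i\<in>{1..n}. 2 * a i * (2 * q i * (1 - q i) * h i)) =
          (\<Sum>i\<in>{1..n}. - \<theta> / sqrt n * ((a i)\<^sup>2 * (4 * q i * (1 - q i))))"
        unfolding h_def by (intro sum.cong) (auto simp: power2_eq_square)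
      then show ?thesis unfolding V(1) sum_distrib_left[symmetric] using n by simp
    qed
    also have "\<dots> = - (K + 3 * M) * (n / sqrt n)" using Vpos sn by (simp add: \<theta>_def field_simps)
    also have "n / sqrt n = sqrt n" using n by (simp add: real_div_sqrt)
    finally have "\<mu> + (K + 3 * M) * sqrt n = \<mu> - (\<Sum>i\<in>{1..n}. 2 * a i * (2 * q i * (1 - q i) * h i))" by (simp add: algebra_simps)
    also have "\<dots> = (\<Sum>i\<in>{1..n}. 2 * a i * (r i - q i - 2 * q i * (1 - q i) * h i))"
      unfolding \<mu>_def sum_subtractf[symmetric] by (intro sum.cong) (auto simp: algebra_simps)
    also have "\<bar>\<dots>\<bar> \<le> (\<Sum>i\<in>{1..n}. \<bar>2 * a i * (r i - q i - 2 * q i * (1 - q i) * h i)\<bar>)" by (rule sum_abs)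
    also have "\<dots> \<le> (\<Sum>i\<in>{1..n}. 2 * M * (18 * ((L * M)\<^sup>2 / n)))"
    proof (rule sum_mono)
      fix i assume i: "i \<in> {1..n}"
      have "\<bar>r i - q i - 2 * q i * (1 - q i) * h i\<bar> \<le> 18 * (h i)\<^sup>2"
        unfolding r_def using tilt_approx q[OF i] h8[OF i] by auto
      then have "\<bar>r i - q i - 2 * q i * (1 - q i) * h i\<bar> \<le> 18 * ((L * M)\<^sup>2 / n)" using h2[OF i] by linarith
      then show "\<bar>2 * a i * (r i - q i - 2 * q i * (1 - q i) * h i)\<bar> \<le> 2 * M * (18 * ((L * M)\<^sup>2 / n))"
        unfolding abs_mult using a[OF i] M by (intro mult_mono) auto
    qed
    also have "\<dots> = M * (36 * (L * M)\<^sup>2)" using n by simp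
    also have "\<dots> \<le> M * sqrt n" using n1(3) M by (intro mult_left_mono) auto
    finally show ?thesis .
  qed
  \<comment> \<open>Radius \<open>2 * M * sqrt n\<close> gives Chebyshev failure probability 1/4.
    With the error \<open>M * sqrt n\<close> of the mean, \<open>W\<close> stays within
    \<open>3 * M * sqrt n\<close> of \<open>- (K + 3 * M) * sqrt n\<close>, which is exactly the
    window \<open>good\<close>.\<close>
  have "bprob n r (\<lambda>x. \<not> \<bar>centered_sum n r a x\<bar> \<ge> 2 * M * sqrt n) \<ge> 1 - M\<^sup>2 * real n / (2 * M * sqrt n)\<^sup>2"
    unfolding bprob_not using chebyshev_centered_sum[where q=r and a=a and M=M and n=n and r="2 * M * sqrt n"] r01 a M sn by simp
  moreover have "M\<^sup>2 * real n / (2 * M * sqrt n)\<^sup>2 = 1/4" using M n by (simp add: power_mult_distrib)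
  moreover have "bprob n r (\<lambda>x. \<not> \<bar>centered_sum n r a x\<bar> \<ge> 2 * M * sqrt n) \<le> bprob n r good"
  proof (rule bprob_mono[OF r01])
    fix x assume "\<not> 2 * M * sqrt n \<le> \<bar>centered_sum n r a x\<bar>"
    then have "\<bar>W x - \<mu>\<bar> < 2 * M * sqrt n" unfolding W_def \<mu>_def centered_sum_shift[of n q a x r] by simp
    then show "good x" using mu unfolding good_def by (auto simp: algebra_simps)
  qed
  ultimately have good: "bprob n r good \<ge> 3/4" by simp
  have prod: "(\<Prod>i\<in>{1..n}. mgf (q i) (h i)) \<ge> exp (\<theta>\<^sup>2 * V / 2 - 1)"
  proof -
    have "\<theta>\<^sup>2 * V / 2 = (\<Sum>i\<in>{1..n}. (h i)\<^sup>2 * (4 * q i * (1 - q i)) / 2)"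
      using n unfolding V(1) h_def by (simp add: sum_distrib_left sum_divide_distrib power_mult_distrib power_divide mult_ac)
    then have "exp (\<theta>\<^sup>2 * V / 2 - 1) \<le> exp (\<Sum>i\<in>{1..n}. (h i)\<^sup>2 * (4 * q i * (1 - q i)) / 2 - 9 * \<bar>h i\<bar> ^ 3)"
      using h3 by (simp add: sum_subtractf)
    also have "\<dots> = (\<Prod>i\<in>{1..n}. exp ((h i)\<^sup>2 * (4 * q i * (1 - q i)) / 2 - 9 * \<bar>h i\<bar> ^ 3))"
      by (rule exp_sum) auto
    also have "\<dots> \<le> (\<Prod>i\<in>{1..n}. mgf (q i) (h i))"
      using q h8 mgf_lower by (intro prod_mono) auto
    finally show ?thesis .
  qed
  \<comment> \<open>Undoing the tilt: on the window \<open>W\<close> is at least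
    \<open>- (K + 6 * M) * sqrt n\<close>, so the density of the original law relative to the tilted
    one is bounded below.\<close>
  have "exp (\<theta>\<^sup>2 * V / 2 - 1) * exp (- \<theta> * (K + 6 * M)) * bprob n r good \<le> bprob n q good"
    unfolding bprob_def sum_distrib_left
  proof (rule sum_mono)
    fix x assume x: "x \<in> cube n"
    have "exp (\<theta>\<^sup>2 * V / 2 - 1) * exp (- \<theta> * (K + 6 * M)) * bern n r x \<le> bern n q x" if "good x"
    proof -
      have hx: "centered_sum n q h x = - \<theta> / sqrt n * W x" unfolding h_def W_def by (rule centered_sum_scale)
      have "\<theta> / sqrt n * (- (K + 6 * M) * sqrt n) \<le> \<theta> / sqrt n * W x"
        using that th sn unfolding good_def by (intro mult_left_mono) auto
      then have 1: "- \<theta> * (K + 6 * M) \<le> - centered_sum n q h x" unfolding hx using sn by (simp add: algebra_simps)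
      have "bern n q x = bern n r x * ((\<Prod>i\<in>{1..n}. mgf (q i) (h i)) * exp (- centered_sum n q h x))"
        using bern_tilt[OF q x, where h=h] unfolding r_def by (simp add: exp_minus field_simps)
      also have "\<dots> \<ge> bern n r x * (exp (\<theta>\<^sup>2 * V / 2 - 1) * exp (- \<theta> * (K + 6 * M)))"
        using prod 1 bern_nonneg[OF r01, where x=x] order_trans[OF exp_ge_zero prod]
        by (intro mult_left_mono mult_mono) auto
      finally show ?thesis by (simp add: mult_ac)
    qed
    then show "exp (\<theta>\<^sup>2 * V / 2 - 1) * exp (- \<theta> * (K + 6 * M)) * (if good x then bern n r x else 0)
       \<le> (if good x then bern n q x else 0)" by auto
  qed
  moreover have "exp (\<theta>\<^sup>2 * V / 2 - 1) * exp (- \<theta> * (K + 6 * M)) * (3/4) \<le>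
       exp (\<theta>\<^sup>2 * V / 2 - 1) * exp (- \<theta> * (K + 6 * M)) * bprob n r good"
    using good by (intro mult_left_mono) auto
  moreover have "- 1 - (K + 9 * M)\<^sup>2 / (2 * V) \<le> \<theta>\<^sup>2 * V / 2 - 1 + - \<theta> * (K + 6 * M)"
  proof -
    have "\<theta> * (K + 6 * M) - \<theta>\<^sup>2 * V / 2 = (K + 3 * M) * (K + 9 * M) / (2 * V)"
      using Vpos by (simp add: \<theta>_def field_simps power2_eq_square)
    also have "\<dots> \<le> (K + 9 * M)\<^sup>2 / (2 * V)"
      using Vpos M K unfolding power2_eq_square by (intro divide_right_mono mult_right_mono) auto
    finally show ?thesis by simp
  qed
  then have "exp (- 1 - (K + 9 * M)\<^sup>2 / (2 * V)) \<le> exp (\<theta>\<^sup>2 * V / 2 - 1) * exp (- \<theta> * (K + 6 * M))"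
    by (simp flip: exp_add)
  ultimately have "3/4 * exp (- 1 - (K + 9 * M)\<^sup>2 / (2 * V)) \<le> bprob n q good" by linarith
  then show ?thesis unfolding good_def W_def .
qed

text \<open>Markov's inequality for the exponential of a combination of the two sums, with weight
  \<open>- A / sqrt n\<close> on the first and \<open>b / sqrt n\<close> on the second. The gain
  over a one-parameter bound is the cross term \<open>- A * b * C\<close>, with \<open>C\<close> the
  normalized covariance.\<close>

lemma upper_tail:
  assumes q: "\<And>i. i \<in> {1..n} \<Longrightarrow> 0 \<le> q i \<and> q i \<le> 1"
    and a: "\<And>i. i \<in> {1..n} \<Longrightarrow> \<bar>a i\<bar> \<le> M" and c: "\<And>i. i \<in> {1..n} \<Longrightarrow> \<bar>c i\<bar> \<le> M" and n: "n > 0"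
    and V: "V = (\<Sum>i\<in>{1..n}. (a i)\<^sup>2 * (4 * q i * (1 - q i))) / real n"
    and C: "C = (\<Sum>i\<in>{1..n}. a i * c i * (4 * q i * (1 - q i))) / real n"
    and D: "D = (\<Sum>i\<in>{1..n}. (c i)\<^sup>2 * (4 * q i * (1 - q i))) / real n"
    and A: "0 \<le> A" "0 \<le> b" "A + b \<le> B"
    and n1: "8 * (B * M) \<le> sqrt n" "9 * (B * M) ^ 3 \<le> sqrt n"
  shows "bprob n q (\<lambda>x. centered_sum n q a x \<le> - K * sqrt n \<and> - K' * sqrt n \<le> centered_sum n q c x)
    \<le> exp (- A * K + b * K' + A\<^sup>2 * V / 2 - A * b * C + b\<^sup>2 * D / 2 + 1)"
proof -
  define h where "h = (\<lambda>i. (- A / sqrt n) * a i + (b / sqrt n) * c i)"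
  have sn: "sqrt n > 0" and snn: "sqrt n * sqrt n = n" using n by auto
  have hb: "\<bar>h i\<bar> \<le> B * M / sqrt n" if i: "i \<in> {1..n}" for i
  proof -
    have "\<bar>h i\<bar> \<le> A / sqrt n * \<bar>a i\<bar> + b / sqrt n * \<bar>c i\<bar>"
      unfolding h_def using A sn by (intro order_trans[OF abs_triangle_ineq]) (auto simp: abs_mult)
    also have "\<dots> \<le> A / sqrt n * M + b / sqrt n * M"
      using a[OF i] c[OF i] A sn by (intro add_mono mult_left_mono) auto
    also have "\<dots> = (A + b) * M / sqrt n" by (simp add: algebra_simps add_divide_distrib)
    also have "\<dots> \<le> B * M / sqrt n" using A sn order_trans[OF abs_ge_zero a[OF i]]
      by (intro divide_right_mono mult_right_mono) auto
    finally show ?thesis .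
  qed
  have BM: "B * M / sqrt n \<le> 1/8" using n1(1) sn by (simp add: field_simps)
  have h3: "(\<Sum>i\<in>{1..n}. 9 * \<bar>h i\<bar> ^ 3) \<le> 1"
  proof -
    have "(\<Sum>i\<in>{1..n}. 9 * \<bar>h i\<bar> ^ 3) \<le> (\<Sum>i\<in>{1..n}. 9 * (B * M / sqrt n) ^ 3)"
      using hb by (intro sum_mono mult_left_mono power_mono) auto
    also have "\<dots> = 9 * (B * M) ^ 3 / sqrt n"
      using sn snn by (simp add: power_divide eval_nat_numeral)
    also have "\<dots> \<le> 1" using n1(2) sn by simp
    finally show ?thesis .
  qed
  have "bprob n q (\<lambda>x. centered_sum n q a x \<le> - K * sqrt n \<and> - K' * sqrt n \<le> centered_sum n q c x)
     \<le> bexp n q (\<lambda>x. exp (- A * K + b * K') * exp (centered_sum n q h x))"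
    unfolding bprob_eq_bexp
  proof (rule bexp_mono[OF q])
    fix x
    have hx: "centered_sum n q h x = - A / sqrt n * centered_sum n q a x + b / sqrt n * centered_sum n q c x"
      unfolding h_def by (simp only: centered_sum_scale centered_sum_add)
    \<comment> \<open>On the event the exponent is nonnegative, so the exponential dominates the
      indicator.\<close>
    have "0 \<le> - A * K + b * K' + centered_sum n q h x"
      if "centered_sum n q a x \<le> - K * sqrt n" "- K' * sqrt n \<le> centered_sum n q c x"
    proof -
      have "A / sqrt n * centered_sum n q a x \<le> A / sqrt n * (- K * sqrt n)"
        using that A sn by (intro mult_left_mono) auto
      moreover have "b / sqrt n * (- K' * sqrt n) \<le> b / sqrt n * centered_sum n q c x"
        using that A sn by (intro mult_left_mono) auto
      ultimately show ?thesis unfolding hx using sn by (simp add: mult_ac)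
    qed
    then show "(if centered_sum n q a x \<le> - K * sqrt n \<and> - K' * sqrt n \<le> centered_sum n q c x then 1 else 0)
       \<le> exp (- A * K + b * K') * exp (centered_sum n q h x)" by (auto simp flip: exp_add)
  qed
  also have "\<dots> = exp (- A * K + b * K') * (\<Prod>i\<in>{1..n}. mgf (q i) (h i))"
    unfolding bexp_cmult using bexp_exp_centered_sum[OF q] by simp
  also have "(\<Prod>i\<in>{1..n}. mgf (q i) (h i)) \<le> (\<Prod>i\<in>{1..n}. exp ((h i)\<^sup>2 * (4 * q i * (1 - q i)) / 2 + 9 * \<bar>h i\<bar> ^ 3))"
  proof (intro prod_mono conjI)
    fix i assume i: "i \<in> {1..n}"
    show "0 \<le> mgf (q i) (h i)" using mgf_ge_1[of "q i" "h i"] q[OF i] by simp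
    show "mgf (q i) (h i) \<le> exp ((h i)\<^sup>2 * (4 * q i * (1 - q i)) / 2 + 9 * \<bar>h i\<bar> ^ 3)"
      using mgf_upper[of "q i" "h i"] q[OF i] hb[OF i] BM by simp
  qed
  also have "\<dots> = exp ((\<Sum>i\<in>{1..n}. (h i)\<^sup>2 * (4 * q i * (1 - q i)) / 2) + (\<Sum>i\<in>{1..n}. 9 * \<bar>h i\<bar> ^ 3))"
    by (simp add: exp_sum[symmetric] sum.distrib)
  also have "(\<Sum>i\<in>{1..n}. (h i)\<^sup>2 * (4 * q i * (1 - q i)) / 2) = A\<^sup>2 * V / 2 - A * b * C + b\<^sup>2 * D / 2"
  proof -
    have "(h i)\<^sup>2 * (4 * q i * (1 - q i)) / 2 =
       A\<^sup>2 / (2 * n) * ((a i)\<^sup>2 * (4 * q i * (1 - q i))) - A * b / n * (a i * c i * (4 * q i * (1 - q i)))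
       + b\<^sup>2 / (2 * n) * ((c i)\<^sup>2 * (4 * q i * (1 - q i)))" for i
    proof -
      have *: "(h i)\<^sup>2 = (A\<^sup>2 * (a i)\<^sup>2 - 2 * A * b * a i * c i + b\<^sup>2 * (c i)\<^sup>2) / n"
        unfolding h_def using sn snn by (simp add: power2_eq_square field_simps)
      define w where "w = 4 * q i * (1 - q i)"
      show ?thesis unfolding * w_def[symmetric]
        by (simp add: add_divide_distrib diff_divide_distrib distrib_left distrib_right left_diff_distrib right_diff_distrib mult_ac)
    qed
    then have "(\<Sum>i\<in>{1..n}. (h i)\<^sup>2 * (4 * q i * (1 - q i)) / 2) =
       A\<^sup>2 / (2 * n) * (\<Sum>i\<in>{1..n}. (a i)\<^sup>2 * (4 * q i * (1 - q i)))
       - A * b / n * (\<Sum>i\<in>{1..n}. a i * c i * (4 * q i * (1 - q i)))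
       + b\<^sup>2 / (2 * n) * (\<Sum>i\<in>{1..n}. (c i)\<^sup>2 * (4 * q i * (1 - q i)))"
      by (simp only: sum.distrib sum_subtractf sum_distrib_left)
    then show ?thesis using n unfolding V C D by (simp add: field_simps)
  qed
  finally have "bprob n q (\<lambda>x. centered_sum n q a x \<le> - K * sqrt n \<and> - K' * sqrt n \<le> centered_sum n q c x)
    \<le> exp (- A * K + b * K') * exp (A\<^sup>2 * V / 2 - A * b * C + b\<^sup>2 * D / 2 + (\<Sum>i\<in>{1..n}. 9 * \<bar>h i\<bar> ^ 3))"
    by simp
  also have "\<dots> \<le> exp (- A * K + b * K') * exp (A\<^sup>2 * V / 2 - A * b * C + b\<^sup>2 * D / 2 + 1)"
    using h3 by simp
  finally show ?thesis by (simp add: algebra_simps flip: exp_add)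
qed

text \<open>Given that the sum with coefficients \<open>a\<close> is atypically low, a positively
  correlated sum is unlikely to stay near its mean: the Chernoff exponent gains a term quadratic in
  \<open>K\<close>, while the lower bound by tilting loses only a linear one. \<open>K0\<close> is
  independent of \<open>K1\<close>, and \<open>N\<close> is uniform over \<open>K\<close> between
  them.\<close>

lemma tail_ratio:
  fixes M m w e K' :: real
  assumes M: "0 < M" and m: "0 < m" and w: "0 < w" and e: "0 < e" and K': "0 < K'"
  shows "\<exists>K0>0. \<forall>K1\<ge>K0. \<exists>N. \<forall>n\<ge>N. \<forall>q a c K.
    (\<forall>i\<in>{1..n}. 0 \<le> q i \<and> q i \<le> 1 \<and> w \<le> 4 * q i * (1 - q i) \<and> m \<le> a i * a i \<and> \<bar>a i\<bar> \<le> M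
        \<and> \<bar>c i\<bar> \<le> M \<and> m \<le> a i * c i) \<and> K0 \<le> K \<and> K \<le> K1 \<longrightarrow>
    3/4 * exp (- 1 - (K + 9 * M)\<^sup>2 / (2 * (m * w))) \<le>
      bprob n q (\<lambda>x. - (K + 6 * M) * sqrt n \<le> centered_sum n q a x \<and> centered_sum n q a x \<le> - K * sqrt n) \<and>
    bprob n q (\<lambda>x. centered_sum n q a x \<le> - K * sqrt n \<and> - K' * sqrt n \<le> centered_sum n q c x) \<le>
      e * bprob n q (\<lambda>x. - (K + 6 * M) * sqrt n \<le> centered_sum n q a x \<and> centered_sum n q a x \<le> - K * sqrt n)"
proof -
  \<comment> \<open>\<open>v0\<close> bounds \<open>V\<close> and \<open>C\<close> from below,
    \<open>\<kappa>\<close> bounds \<open>C / V\<close> from below, and \<open>\<rho>\<close> is the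
    rate of the quadratic gain. \<open>B\<close> and \<open>D\<close> collect the linear and
    constant losses. \<open>K0\<close> is large enough that \<open>\<rho> * K\<^sup>2\<close>
    exceeds \<open>B * K + D\<close> and that \<open>K'\<close> is at most
    \<open>\<kappa> * K / 2\<close>.\<close>
  define v0 where "v0 = m * w"
  define \<kappa> where "\<kappa> = v0 / M\<^sup>2"
  define \<rho> where "\<rho> = \<kappa>\<^sup>2 / (8 * M\<^sup>2)"
  define B where "B = 18 * M / (2 * v0)"
  define D where "D = \<bar>2 + 81 * M\<^sup>2 / (2 * v0) - ln (e * (3/4))\<bar>"
  define K0 where "K0 = 1 + (B + D) / \<rho> + 2 * K' / \<kappa>"
  have pos: "v0 > 0" "\<kappa> > 0" "\<rho> > 0" "B > 0" "D \<ge> 0"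
    using M m w by (auto simp: v0_def \<kappa>_def \<rho>_def B_def D_def)
  have "K0 \<ge> 1" using pos K' by (simp add: K0_def)
  moreover have "\<exists>N. \<forall>n\<ge>N. \<forall>q a c K.
    (\<forall>i\<in>{1..n}. 0 \<le> q i \<and> q i \<le> 1 \<and> w \<le> 4 * q i * (1 - q i) \<and> m \<le> a i * a i \<and> \<bar>a i\<bar> \<le> M
        \<and> \<bar>c i\<bar> \<le> M \<and> m \<le> a i * c i) \<and> K0 \<le> K \<and> K \<le> K1 \<longrightarrow>
    3/4 * exp (- 1 - (K + 9 * M)\<^sup>2 / (2 * (m * w))) \<le>
      bprob n q (\<lambda>x. - (K + 6 * M) * sqrt n \<le> centered_sum n q a x \<and> centered_sum n q a x \<le> - K * sqrt n) \<and>
    bprob n q (\<lambda>x. centered_sum n q a x \<le> - K * sqrt n \<and> - K' * sqrt n \<le> centered_sum n q c x) \<le>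
      e * bprob n q (\<lambda>x. - (K + 6 * M) * sqrt n \<le> centered_sum n q a x \<and> centered_sum n q a x \<le> - K * sqrt n)"
    if K1: "K0 \<le> K1" for K1
  proof -
    define L where "L = (K1 + 3 * M) / v0"
    define Q where "Q = K1 / v0 + \<kappa> * K1 / (2 * M\<^sup>2)"
    \<comment> \<open>\<open>L\<close> bounds the tilting parameter of lower_tail, \<open>Q\<close> the sum of the two Chernoff parameters.\<close>
    define R where "R = max (max (8 * (L * M)) (9 * (L * M) ^ 3)) (max (36 * (L * M)\<^sup>2) (max (8 * (Q * M)) (9 * (Q * M) ^ 3)))"
    define N where "N = nat \<lceil>R\<^sup>2\<rceil> + 1"
    show ?thesis
    proof (intro exI[of _ N] allI impI)
      fix n q a c K
      assume n: "N \<le> n" and hyp: "(\<forall>i\<in>{1..n}. 0 \<le> q i \<and> q i \<le> 1 \<and> w \<le> 4 * q i * (1 - q i) \<and> m \<le> a i * a i \<and> \<bar>a i\<bar> \<le> M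
        \<and> \<bar>c i\<bar> \<le> M \<and> m \<le> a i * c i) \<and> K0 \<le> K \<and> K \<le> K1"
      have n0: "n > 0" using n by (simp add: N_def)
      have "R\<^sup>2 \<le> n" using n unfolding N_def by linarith
      then have R: "R \<le> sqrt n" by (rule real_le_rsqrt)
      have q: "\<And>i. i \<in> {1..n} \<Longrightarrow> 0 \<le> q i \<and> q i \<le> 1"
        and a: "\<And>i. i \<in> {1..n} \<Longrightarrow> \<bar>a i\<bar> \<le> M" and c: "\<And>i. i \<in> {1..n} \<Longrightarrow> \<bar>c i\<bar> \<le> M"
        and K: "K0 \<le> K" "K \<le> K1" using hyp by auto
      define V where "V = (\<Sum>i\<in>{1..n}. (a i)\<^sup>2 * (4 * q i * (1 - q i))) / real n"
      define C where "C = (\<Sum>i\<in>{1..n}. a i * c i * (4 * q i * (1 - q i))) / real n"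
      define Dc where "Dc = (\<Sum>i\<in>{1..n}. (c i)\<^sup>2 * (4 * q i * (1 - q i))) / real n"
      have lb: "m * w \<le> (\<Sum>i\<in>{1..n}. a i * f i * (4 * q i * (1 - q i))) / real n"
        if "\<And>i. i \<in> {1..n} \<Longrightarrow> m \<le> a i * f i" for f
      proof -
        have "(\<Sum>i\<in>{1..n}. m * w) \<le> (\<Sum>i\<in>{1..n}. a i * f i * (4 * q i * (1 - q i)))"
          using that hyp m w by (intro sum_mono mult_mono) (auto intro: order_trans[of 0 m])
        then show ?thesis using n0 by (simp add: field_simps)
      qed
      have ub: "(\<Sum>i\<in>{1..n}. (f i)\<^sup>2 * (4 * q i * (1 - q i))) / real n \<le> M\<^sup>2"
        if "\<And>i. i \<in> {1..n} \<Longrightarrow> \<bar>f i\<bar> \<le> M" for f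
      proof -
        have "(\<Sum>i\<in>{1..n}. (f i)\<^sup>2 * (4 * q i * (1 - q i))) \<le> (\<Sum>i\<in>{1..n}. M\<^sup>2 * 1)"
        proof (intro sum_mono mult_mono var_le_1)
          fix i assume i: "i \<in> {1..n}"
          show "(f i)\<^sup>2 \<le> M\<^sup>2" using power_mono[OF that[OF i], of 2] by simp
          show "0 \<le> 4 * q i * (1 - q i)" using q[OF i] by simp
        qed auto
        then show ?thesis using n0 by (simp add: field_simps)
      qed
      have V: "v0 \<le> V" "V \<le> M\<^sup>2" using lb[of a] ub[of a] hyp by (auto simp: V_def v0_def power2_eq_square)
      have C: "v0 \<le> C" using lb[of c] hyp by (auto simp: C_def v0_def)
      have Dc: "Dc \<le> M\<^sup>2" using ub[of c] c by (auto simp: Dc_def)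
      have Vpos: "V > 0" using V pos by simp
      have Kpos: "K \<ge> 1" using K \<open>K0 \<ge> 1\<close> by simp
      \<comment> \<open>\<open>A\<close> minimizes \<open>- A * K + A\<^sup>2 * V / 2\<close>.
        \<open>b\<close> minimizes
        \<open>- b * (\<kappa> * K / 2) + b\<^sup>2 * M\<^sup>2 / 2\<close>, and the minimum is
        \<open>- \<rho> * K\<^sup>2\<close>.\<close>
      define A where "A = K / V"
      define b where "b = \<kappa> * K / (2 * M\<^sup>2)"
      define P where "P = bprob n q (\<lambda>x. - (K + 6 * M) * sqrt n \<le> centered_sum n q a x \<and> centered_sum n q a x \<le> - K * sqrt n)"
      have low: "3/4 * exp (- 1 - (K + 9 * M)\<^sup>2 / (2 * V)) \<le> P"
        unfolding P_def
        by (rule lower_tail[OF q a M n0 V_def V(1) pos(1) _ K(2) L_def]) (use R Kpos in \<open>auto simp: R_def\<close>)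
      \<comment> \<open>Replacing \<open>V\<close> by \<open>v0\<close> makes the lower bound
        uniform in \<open>n\<close> and in the coefficients.\<close>
      have "exp (- 1 - (K + 9 * M)\<^sup>2 / (2 * v0)) \<le> exp (- 1 - (K + 9 * M)\<^sup>2 / (2 * V))"
        using V(1) pos by (simp add: frac_le)
      then have one: "3/4 * exp (- 1 - (K + 9 * M)\<^sup>2 / (2 * (m * w))) \<le> P" using low unfolding v0_def by linarith
      have AB: "0 \<le> A" "0 \<le> b" "A + b \<le> Q"
        using Vpos pos M Kpos V K unfolding A_def b_def Q_def
        by (auto intro!: add_mono frac_le divide_right_mono mult_left_mono)
      have up: "bprob n q (\<lambda>x. centered_sum n q a x \<le> - K * sqrt n \<and> - K' * sqrt n \<le> centered_sum n q c x)
          \<le> exp (- A * K + b * K' + A\<^sup>2 * V / 2 - A * b * C + b\<^sup>2 * Dc / 2 + 1)"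
        by (rule upper_tail[OF q a c n0 V_def C_def Dc_def AB]) (use R in \<open>auto simp: R_def\<close>)
      have expo: "- A * K + b * K' + A\<^sup>2 * V / 2 - A * b * C + b\<^sup>2 * Dc / 2 + 1 \<le> - K\<^sup>2 / (2 * V) - \<rho> * K\<^sup>2 + 1"
      proof -
        have 1: "- A * K + A\<^sup>2 * V / 2 = - K\<^sup>2 / (2 * V)"
          using Vpos by (simp add: A_def power2_eq_square field_simps)
        have "\<kappa> \<le> C / V" unfolding \<kappa>_def using C V Vpos pos M by (intro frac_le) auto
        then have "K * b * \<kappa> \<le> K * b * (C / V)" using Kpos AB by (intro mult_left_mono) auto
        then have 2: "K * b * \<kappa> \<le> A * b * C" by (simp add: A_def mult_ac)
        \<comment> \<open>Half of the covariance gain \<open>K * b * \<kappa>\<close> pays for the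
          term \<open>b * K'\<close>.\<close>
        have "K' \<le> \<kappa> * K / 2"
        proof -
          have "2 * K' / \<kappa> \<le> K" using K pos K' unfolding K0_def
            by (smt (verit) divide_nonneg_pos)
          then show ?thesis using pos by (simp add: field_simps)
        qed
        then have 3: "b * K' \<le> b * (\<kappa> * K / 2)" using AB by (intro mult_left_mono) auto
        have 4: "b\<^sup>2 * Dc / 2 \<le> b\<^sup>2 * M\<^sup>2 / 2" using Dc by (intro divide_right_mono mult_left_mono) auto
        have 5: "b * (\<kappa> * K / 2) - K * b * \<kappa> + b\<^sup>2 * M\<^sup>2 / 2 = - \<rho> * K\<^sup>2"
          using M by (simp add: b_def \<rho>_def power2_eq_square field_simps)
        show ?thesis using 1 2 3 4 5 by linarith
      qed
      \<comment> \<open>The two leading terms \<open>K\<^sup>2 / (2 * V)\<close> agree, so the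
        difference of exponents is linear in \<open>K\<close> and is beaten by
        \<open>\<rho> * K\<^sup>2\<close>. Both bounds use the same \<open>V\<close>, which is
        essential for this cancellation.\<close>
      have cmp: "- K\<^sup>2 / (2 * V) - \<rho> * K\<^sup>2 + 1 \<le> ln (e * (3/4)) + (- 1 - (K + 9 * M)\<^sup>2 / (2 * V))"
      proof -
        have "(B + D) / \<rho> \<le> K" using K pos K' unfolding K0_def
          by (smt (verit) divide_nonneg_pos)
        then have "(B + D) * K \<le> \<rho> * K * K" using pos Kpos by (intro mult_right_mono) (auto simp: field_simps)
        moreover have "D * 1 \<le> D * K" using pos Kpos by (intro mult_left_mono) auto
        ultimately have 1: "B * K + D \<le> \<rho> * K\<^sup>2" by (simp add: power2_eq_square algebra_simps)
        have "(K + 9 * M)\<^sup>2 / (2 * V) - K\<^sup>2 / (2 * V) = (18 * M * K + 81 * M\<^sup>2) / (2 * V)"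
          by (simp add: power2_eq_square algebra_simps flip: diff_divide_distrib)
        also have "\<dots> \<le> (18 * M * K + 81 * M\<^sup>2) / (2 * v0)"
          using V pos M Kpos by (intro divide_left_mono) auto
        also have "\<dots> = B * K + 81 * M\<^sup>2 / (2 * v0)" by (simp add: B_def add_divide_distrib)
        finally show ?thesis using 1 unfolding D_def by linarith
      qed
      have "exp (- K\<^sup>2 / (2 * V) - \<rho> * K\<^sup>2 + 1) \<le> e * (3/4) * exp (- 1 - (K + 9 * M)\<^sup>2 / (2 * V))"
      proof -
        have "exp (ln (e * (3/4)) + (- 1 - (K + 9 * M)\<^sup>2 / (2 * V))) = e * (3/4) * exp (- 1 - (K + 9 * M)\<^sup>2 / (2 * V))"
          unfolding exp_add using e by simp
        then show ?thesis using cmp by (metis exp_le_cancel_iff)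
      qed
      also have "\<dots> \<le> e * P" using low e by simp
      finally have "exp (- K\<^sup>2 / (2 * V) - \<rho> * K\<^sup>2 + 1) \<le> e * P" .
      moreover have "exp (- A * K + b * K' + A\<^sup>2 * V / 2 - A * b * C + b\<^sup>2 * Dc / 2 + 1) \<le> exp (- K\<^sup>2 / (2 * V) - \<rho> * K\<^sup>2 + 1)"
        using expo by simp
      ultimately show "3/4 * exp (- 1 - (K + 9 * M)\<^sup>2 / (2 * (m * w))) \<le>
      bprob n q (\<lambda>x. - (K + 6 * M) * sqrt n \<le> centered_sum n q a x \<and> centered_sum n q a x \<le> - K * sqrt n) \<and>
    bprob n q (\<lambda>x. centered_sum n q a x \<le> - K * sqrt n \<and> - K' * sqrt n \<le> centered_sum n q c x) \<le>
      e * bprob n q (\<lambda>x. - (K + 6 * M) * sqrt n \<le> centered_sum n q a x \<and> centered_sum n q a x \<le> - K * sqrt n)"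
        using one up unfolding P_def by (intro conjI) linarith+
    qed
  qed
  ultimately show ?thesis by (intro exI[of _ K0]) auto
qed

section \<open>Entropy and the risk minimizer\<close>

lemma Hbin_logistic: "Hbin (exp s / (1 + exp s)) = ln (1 + exp s) - s * (exp s / (1 + exp s))"
proof -
  have pos: "1 + exp s > 0" by (simp add: add_pos_pos)
  have 1: "1 - exp s / (1 + exp s) = 1 / (1 + exp s)" using pos by (simp add: field_simps)
  have 2: "ln (exp s / (1 + exp s)) = s - ln (1 + exp s)" using pos by (simp add: ln_div)
  have 3: "ln (1 / (1 + exp s)) = - ln (1 + exp s)" using pos by (simp add: ln_div)
  define q where "q = exp s / (1 + exp s)"
  have 4: "ln (1 - q) = - ln (1 + exp s)" using 1 3 by (simp add: q_def)
  show ?thesis using 2 unfolding Hbin_def q_def[symmetric] 4 by (simp only:) (simp add: algebra_simps)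
qed

lemma Hbin_one_minus: "Hbin (1 - q) = Hbin q"
  by (simp add: Hbin_def algebra_simps)

lemma Hbin_logistic_minus: "Hbin (exp (- s) / (1 + exp (- s))) = Hbin (exp s / (1 + exp s))"
proof -
  have pos: "1 + exp s > 0" by (simp add: add_pos_pos)
  have 1: "exp (- s) / (1 + exp (- s)) = 1 - exp s / (1 + exp s)" 
    using pos by (simp add: exp_minus field_simps)
  show ?thesis unfolding 1 by (rule Hbin_one_minus)
qed

lemma Hbin_logistic_abs: "Hbin (exp \<bar>s\<bar> / (1 + exp \<bar>s\<bar>)) = Hbin (exp s / (1 + exp s))"
  by (cases "s \<ge> 0") (simp_all add: Hbin_logistic_minus)

text \<open>The derivative of the closed form is \<open>- x * exp x / (1 + exp x)\<^sup>2\<close>.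
  It vanishes at 0, hence the monotonicity criterion that asks for a negative derivative only in the
  open interval.\<close>

lemma Hbin_logistic_strict_antimono:
  assumes "0 \<le> s" "s < t"
  shows "Hbin (exp t / (1 + exp t)) < Hbin (exp s / (1 + exp s))"
  unfolding Hbin_logistic
proof (rule DERIV_neg_imp_decreasing_open[OF assms(2)])
  fix x assume x: "s < x" "x < t"
  have pos: "1 + exp x > 0" by (simp add: add_pos_pos)
  have "((\<lambda>x. ln (1 + exp x) - x * (exp x / (1 + exp x))) has_real_derivative
      - (x * (exp x / (1 + exp x)\<^sup>2))) (at x)"
  proof (rule DERIV_cong)
    have "((\<lambda>x. exp x / (1 + exp x)) has_real_derivative
        (exp x * (1 + exp x) - exp x * exp x) / ((1 + exp x) * (1 + exp x))) (at x)"
      using pos by (auto intro!: derivative_eq_intros)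
    then have "((\<lambda>x. exp x / (1 + exp x)) has_real_derivative exp x / (1 + exp x)\<^sup>2) (at x)"
      by (simp add: power2_eq_square algebra_simps)
    moreover have "((\<lambda>x. ln (1 + exp x)) has_real_derivative exp x / (1 + exp x)) (at x)"
      using pos by (auto intro!: derivative_eq_intros)
    ultimately show "((\<lambda>x. ln (1 + exp x) - x * (exp x / (1 + exp x))) has_real_derivative
      exp x / (1 + exp x) - (1 * (exp x / (1 + exp x)) + exp x / (1 + exp x)\<^sup>2 * x)) (at x)"
      by (intro DERIV_diff DERIV_mult DERIV_ident)
  qed simp
  moreover have "- (x * (exp x / (1 + exp x)\<^sup>2)) < 0" using x assms pos by simp
  ultimately show "\<exists>y. ((\<lambda>x. ln (1 + exp x) - x * (exp x / (1 + exp x))) has_real_derivative y) (at x) \<and> y < 0"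
    by blast
next
  have "1 + exp x \<noteq> 0" for x :: real using exp_gt_zero[of x] by linarith
  then show "continuous_on {s..t} (\<lambda>x. ln (1 + exp x) - x * (exp x / (1 + exp x)))"
    by (intro continuous_intros) auto
qed

text \<open>Evenness reduces the comparison to nonnegative arguments, where the entropy strictly
  decreases. High entropy thus becomes a small absolute value of the linear form.\<close>

lemma Hbin_logistic_le_iff:
  "Hbin (exp s / (1 + exp s)) \<le> Hbin (exp t / (1 + exp t)) \<longleftrightarrow> \<bar>t\<bar> \<le> \<bar>s\<bar>"
  using Hbin_logistic_strict_antimono[of "\<bar>s\<bar>" "\<bar>t\<bar>"] Hbin_logistic_strict_antimono[of "\<bar>t\<bar>" "\<bar>s\<bar>"]
  unfolding Hbin_logistic_abs by (cases "\<bar>s\<bar>" "\<bar>t\<bar>" rule: linorder_cases) (auto, metis Hbin_logistic_abs order_refl)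

section \<open>Conditioning on Z, and the normal equations of the risk minimizer\<close>

lemma sum_triples:
  "(\<Sum>(x, y, z)\<in>triples n. Dpmf n \<eta> p p' x y z * f x y z) =
    1/2 * bexp n p (\<lambda>x. (1 - \<eta>) * f x 1 1 + \<eta> * f x (-1) 1) +
    1/2 * bexp n p' (\<lambda>x. (1 - \<eta>) * f x (-1) (-1) + \<eta> * f x 1 (-1))"
  unfolding triples_def sum.cartesian_product[symmetric] bexp_def sum_distrib_left sum.distrib[symmetric]
  by (intro sum.cong refl) (simp add: Dpmf_def algebra_simps add_divide_distrib diff_divide_distrib)

text \<open>For events that ignore the label, the weights \<open>1 - \<eta>\<close> and
  \<open>\<eta>\<close> add up to 1, so the noise disappears.\<close>

lemma probD_eq:
  "probD n \<eta> p p' (\<lambda>x y z. Q x z) = 1/2 * bprob n p (\<lambda>x. Q x 1) + 1/2 * bprob n p' (\<lambda>x. Q x (-1))"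
proof -
  have "probD n \<eta> p p' (\<lambda>x y z. Q x z) =
      (\<Sum>(x, y, z)\<in>triples n. Dpmf n \<eta> p p' x y z * (if Q x z then 1 else 0))"
    unfolding probD_def by (intro sum.cong) auto
  then show ?thesis unfolding sum_triples bprob_eq_bexp by (simp flip: distrib_right)
qed

text \<open>Fisher's linear discriminant for the two classes: difference of means over pooled
  variance. The denominator is the average of the class variances \<open>4 * p i * (1 - p i)\<close>
  and \<open>4 * p' i * (1 - p' i)\<close>.\<close>

definition slope :: "(nat \<Rightarrow> real) \<Rightarrow> (nat \<Rightarrow> real) \<Rightarrow> nat \<Rightarrow> real" where
  "slope p p' i = (p i - p' i) / (2 * p i * (1 - p i) + 2 * p' i * (1 - p' i))"

text \<open>The center \<open>p i + p' i - 1\<close> is the mean of \<open>x i\<close> under the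
  balanced mixture.\<close>

definition score :: "nat \<Rightarrow> (nat \<Rightarrow> real) \<Rightarrow> (nat \<Rightarrow> real) \<Rightarrow> (nat \<Rightarrow> real) \<Rightarrow> real" where
  "score n p p' x = (\<Sum>i\<in>{1..n}. slope p p' i * (x i - (p i + p' i - 1)))"

text \<open>The mean of \<open>score n p p'\<close> under \<open>bern n p\<close>, and minus its
  mean under \<open>bern n p'\<close>.\<close>

definition sep :: "nat \<Rightarrow> (nat \<Rightarrow> real) \<Rightarrow> (nat \<Rightarrow> real) \<Rightarrow> real" where
  "sep n p p' = (\<Sum>i\<in>{1..n}. slope p p' i * (p i - p' i))"

lemma slope_swap: "slope p' p i = - slope p p' i"
  by (simp add: slope_def add.commute minus_divide_left)

text \<open>With \<open>sep_swap\<close>, this lets estimates for Z = 1 serve for Z = -1, as only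
  the absolute value of the score enters the entropy.\<close>

lemma score_swap: "score n p' p x = - score n p p' x"
  by (simp add: score_def slope_swap[of p' p] sum_negf add.commute)

lemma sep_swap: "sep n p' p = sep n p p'"
  unfolding sep_def slope_swap[of p' p] by (intro sum.cong) (auto simp: algebra_simps)

lemma centered_sum_slope: "centered_sum n p (slope p p') x = score n p p' x - sep n p p'"
  unfolding centered_sum_def score_def sep_def sum_subtractf[symmetric]
  by (intro sum.cong) (auto simp: algebra_simps)

text \<open>The first-order condition at a minimum, without derivatives: for nonzero
  \<open>L\<close> a small step against its sign makes the expression negative.\<close>

lemma linear_coeff_zero:
  fixes L Q :: real
  assumes "\<And>t. 0 \<le> t * L + t\<^sup>2 * Q"
  shows "L = 0"
proof (rule ccontr)
  assume "L \<noteq> 0"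
  define w where "w = \<bar>Q\<bar> + 1"
  have w: "w > 0" by (simp add: w_def add_nonneg_pos)
  define t where "t = - L / (2 * w)"
  have "t * L + t\<^sup>2 * Q \<le> t * L + t\<^sup>2 * w" by (intro add_left_mono mult_left_mono) (auto simp: w_def)
  also have "\<dots> = - L\<^sup>2 / (4 * w)" using w by (simp add: t_def power2_eq_square field_simps)
  also have "\<dots> < 0" using \<open>L \<noteq> 0\<close> w by (simp add: divide_neg_pos)
  finally show False using assms[of t] by simp
qed

text \<open>Under the mixture the covariance matrix is diagonal plus the rank-one matrix of products
  \<open>d i * d j\<close>. The normal equations therefore make \<open>\<beta>\<close> proportional
  to \<open>d / v\<close>, and the intercept equation centers the form.\<close>

lemma risk_minimizer_score:
  assumes min: "is_risk_minimizer n \<eta> p p' \<beta>" and \<eta>: "\<eta> < 1/2"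
    and p: "\<And>i. i \<in> {1..n} \<Longrightarrow> 0 < p i \<and> p i < 1" and p': "\<And>i. i \<in> {1..n} \<Longrightarrow> 0 < p' i \<and> p' i < 1"
  shows "\<exists>c>0. \<forall>x. \<beta> 0 + (\<Sum>i\<in>{1..n}. \<beta> i * x i) = c * score n p p' x"
proof -
  \<comment> \<open>The label has conditional mean \<open>k * Z\<close> given
    \<open>Z\<close>.\<close>
  define k where "k = 1 - 2 * \<eta>"
  define E where "E = (\<lambda>f. 1/2 * bexp n p f + 1/2 * bexp n p' f)"
  define s where "s = (\<lambda>\<beta> x. \<beta> 0 + (\<Sum>i\<in>{1..n}. \<beta> i * x i :: real))"
  define m where "m = (\<lambda>i. p i + p' i - 1)"
  define d where "d = (\<lambda>i. p i - p' i)"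
  define v where "v = (\<lambda>i. 2 * p i * (1 - p i) + 2 * p' i * (1 - p' i))"
  have E_add: "E (\<lambda>x. f x + g x) = E f + E g" and E_cmult: "E (\<lambda>x. c * f x) = c * E f"
    and E_sum: "E (\<lambda>x. \<Sum>i\<in>I. F i x) = (\<Sum>i\<in>I. E (F i))" for f g c F and I :: "nat set"
    by (simp_all add: E_def bexp_add bexp_cmult bexp_sum sum.distrib sum_distrib_left sum_divide_distrib add_divide_distrib algebra_simps)
  have risk: "risk n \<eta> p p' \<beta> = E (\<lambda>x. (s \<beta> x)\<^sup>2) + 1 - k * (bexp n p (s \<beta>) - bexp n p' (s \<beta>))" for \<beta>
  proof -
    have 1: "(\<lambda>x. (1 - \<eta>) * (s \<beta> x - 1)\<^sup>2 + \<eta> * (s \<beta> x - - 1)\<^sup>2) = (\<lambda>x. (s \<beta> x)\<^sup>2 + (1 + (- 2 * k) * s \<beta> x))"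
      "(\<lambda>x. (1 - \<eta>) * (s \<beta> x - - 1)\<^sup>2 + \<eta> * (s \<beta> x - 1)\<^sup>2) = (\<lambda>x. (s \<beta> x)\<^sup>2 + (1 + 2 * k * s \<beta> x))"
      by (auto simp: k_def power2_eq_square algebra_simps)
    have "risk n \<eta> p p' \<beta> = (\<Sum>(x, y, z)\<in>triples n. Dpmf n \<eta> p p' x y z * (s \<beta> x - y)\<^sup>2)"
      by (simp add: risk_def s_def)
    then show ?thesis unfolding sum_triples[of n \<eta> p p' "\<lambda>x y z. (s \<beta> x - y)\<^sup>2"]
      1 bexp_add bexp_cmult bexp_const E_def by (simp add: algebra_simps)
  qed
  \<comment> \<open>\<open>B t\<close> moves the coefficients so that the linear form changes by
    \<open>t * g\<close>; minimality then kills the coefficient of \<open>t\<close> in the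
    risk.\<close>
  have normal: "2 * E (\<lambda>x. s \<beta> x * g x) = k * (bexp n p g - bexp n p' g)"
    if g: "\<And>t x. s (B t) x = s \<beta> x + t * g x" for B g
  proof -
    have "0 \<le> t * (2 * E (\<lambda>x. s \<beta> x * g x) - k * (bexp n p g - bexp n p' g)) + t\<^sup>2 * E (\<lambda>x. (g x)\<^sup>2)" for t
    proof -
      have sq: "(\<lambda>x. (s (B t) x)\<^sup>2) = (\<lambda>x. (s \<beta> x)\<^sup>2 + (2 * t * (s \<beta> x * g x) + t\<^sup>2 * (g x)\<^sup>2))"
        unfolding g by (auto simp: power2_eq_square algebra_simps)
      have sB: "s (B t) = (\<lambda>x. s \<beta> x + t * g x)" using g by auto
      have "risk n \<eta> p p' \<beta> \<le> risk n \<eta> p p' (B t)" using min by (simp add: is_risk_minimizer_def)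
      then show ?thesis unfolding risk sq E_add E_cmult unfolding sB bexp_add bexp_cmult
        by (simp add: algebra_simps)
    qed
    from linear_coeff_zero[OF this] show ?thesis by simp
  qed
  have n0: "E (s \<beta>) = 0"
    using normal[of "\<lambda>t. \<beta>(0 := \<beta> 0 + t)" "\<lambda>_. 1"] by (simp add: s_def)
  have nj: "E (\<lambda>x. s \<beta> x * x j) = k * d j" if j: "j \<in> {1..n}" for j
  proof -
    have "(\<Sum>i\<in>{1..n}. (\<beta>(j := \<beta> j + t)) i * x i) = (\<Sum>i\<in>{1..n}. \<beta> i * x i) + t * x j" for t and x :: "nat \<Rightarrow> real"
    proof -
      have "(\<Sum>i\<in>{1..n}. (\<beta>(j := \<beta> j + t)) i * x i) = (\<Sum>i\<in>{1..n}. \<beta> i * x i + (if i = j then t * x j else 0))"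
        by (intro sum.cong) (auto simp: algebra_simps)
      then show ?thesis using j by (simp add: sum.distrib)
    qed
    moreover have "j \<noteq> 0" using j by simp
    ultimately have "2 * E (\<lambda>x. s \<beta> x * x j) = k * (bexp n p (\<lambda>x. x j) - bexp n p' (\<lambda>x. x j))"
      by (intro normal[of "\<lambda>t. \<beta>(j := \<beta> j + t)" "\<lambda>x. x j"]) (simp add: s_def)
    also have "bexp n p (\<lambda>x. x j) - bexp n p' (\<lambda>x. x j) = 2 * d j"
      using bexp_coord[OF j, of p "\<lambda>t. t"] bexp_coord[OF j, of p' "\<lambda>t. t"] by (simp add: d_def)
    finally show ?thesis by simp
  qed
  have mean: "E (\<lambda>x. x i - m i) = 0" if "i \<in> {1..n}" for i
    unfolding E_def bexp_coord[OF that, of _ "\<lambda>t. t - m i"] by (simp add: m_def field_simps)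
  \<comment> \<open>The class means contribute \<open>d i * d j\<close>; the average variance within
    the classes contributes \<open>v j\<close>, on the diagonal only.\<close>
  have cov: "E (\<lambda>x. (x i - m i) * (x j - m j)) = d i * d j + (if i = j then v j else 0)"
    if "i \<in> {1..n}" "j \<in> {1..n}" for i j
  proof (cases "i = j")
    case True
    show ?thesis unfolding E_def True bexp_coord[OF that(2), of _ "\<lambda>t. (t - m j) * (t - m j)"]
      by (simp add: m_def d_def v_def algebra_simps)
  next
    case False
    show ?thesis unfolding E_def bexp_coord_pair[OF that False, of _ "\<lambda>t. t - m i" "\<lambda>t. t - m j"]
      using False by (simp add: m_def d_def algebra_simps)
  qed
  define s0 where "s0 = \<beta> 0 + (\<Sum>i\<in>{1..n}. \<beta> i * m i)"
  have s_eq: "s \<beta> = (\<lambda>x. s0 + (\<Sum>i\<in>{1..n}. \<beta> i * (x i - m i)))"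
    by (auto simp: s_def s0_def algebra_simps sum_subtractf)
  have E_const: "E (\<lambda>x. c) = c" for c by (simp add: E_def)
  have s0: "s0 = 0" using n0 unfolding s_eq E_add E_const E_sum E_cmult using mean by simp
  define D where "D = (\<Sum>i\<in>{1..n}. \<beta> i * d i)"
  \<comment> \<open>The rank-one part acts on \<open>\<beta>\<close> through the scalar
    \<open>D\<close> alone, so it moves to the right-hand side of the normal equations.\<close>
  define c where "c = k - D"
  have eqj: "\<beta> j * v j = c * d j" if j: "j \<in> {1..n}" for j
  proof -
    have "E (\<lambda>x. s \<beta> x * (x j - m j)) = k * d j"
    proof -
      have "(\<lambda>x. s \<beta> x * (x j - m j)) = (\<lambda>x. s \<beta> x * x j + (- m j) * s \<beta> x)" by (auto simp: algebra_simps)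
      then show ?thesis using nj[OF j] n0 by (simp only: E_add E_cmult)
    qed
    moreover have "(\<lambda>x. s \<beta> x * (x j - m j)) = (\<lambda>x. \<Sum>i\<in>{1..n}. \<beta> i * ((x i - m i) * (x j - m j)))"
      unfolding s_eq s0 by (simp add: sum_distrib_right mult.assoc)
    ultimately have "k * d j = (\<Sum>i\<in>{1..n}. \<beta> i * (d i * d j + (if i = j then v j else 0)))"
      using cov[OF _ j] by (simp add: E_sum E_cmult)
    also have "\<dots> = (\<Sum>i\<in>{1..n}. \<beta> i * d i * d j + (if i = j then \<beta> j * v j else 0))"
      by (intro sum.cong) (auto simp: algebra_simps)
    also have "\<dots> = D * d j + \<beta> j * v j" using j by (simp add: sum.distrib D_def sum_distrib_right)
    finally show ?thesis by (simp add: c_def algebra_simps)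
  qed
  have v: "v j > 0" if "j \<in> {1..n}" for j
    using p[OF that] p'[OF that] by (simp add: v_def add_pos_pos)
  have beta: "\<beta> j = c * slope p p' j" if j: "j \<in> {1..n}" for j
    using eqj[OF j] v[OF j] unfolding slope_def v_def[symmetric] d_def[symmetric]
    by (simp add: field_simps v_def d_def)
  have "D = c * sep n p p'" unfolding D_def sep_def sum_distrib_left
    using beta by (intro sum.cong) (auto simp: d_def)
  \<comment> \<open>\<open>D\<close> is itself \<open>c\<close> times the separation; this fixes
    \<open>c\<close>, and its sign is that of \<open>k\<close>, positive because
    \<open>\<eta> < 1/2\<close>.\<close>
  then have "c * (1 + sep n p p') = k" by (simp add: c_def algebra_simps)
  moreover have "sep n p p' \<ge> 0"
    unfolding sep_def slope_def
  proof (rule sum_nonneg)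
    fix i assume "i \<in> {1..n}"
    then have "0 < 2 * p i * (1 - p i) + 2 * p' i * (1 - p' i)" using v by (simp add: v_def)
    then show "0 \<le> (p i - p' i) / (2 * p i * (1 - p i) + 2 * p' i * (1 - p' i)) * (p i - p' i)"
      by simp
  qed
  moreover have "k > 0" using \<eta> by (simp add: k_def)
  ultimately have "c > 0" by (smt (verit) mult_nonneg_nonneg mult_nonpos_nonneg)
  moreover have "\<beta> 0 + (\<Sum>i\<in>{1..n}. \<beta> i * x i) = c * score n p p' x" for x
    using fun_cong[OF s_eq, of x] s0 beta unfolding s_def score_def m_def by (simp add: sum_distrib_left mult_ac)
  ultimately show ?thesis by blast
qed

section \<open>High-entropy points\<close>

lemma compact_pos_bounds:
  fixes f :: "'a::topological_space \<Rightarrow> real"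
  assumes "compact S" "continuous_on S f" "\<And>x. x \<in> S \<Longrightarrow> 0 < f x"
  shows "\<exists>l>0. \<exists>u. \<forall>x\<in>S. l \<le> f x \<and> f x \<le> u"
proof (cases "S = {}")
  case False
  obtain a b where "a \<in> S" "\<forall>x\<in>S. f a \<le> f x" "b \<in> S" "\<forall>x\<in>S. f x \<le> f b"
    using continuous_attains_inf[OF assms(1) False assms(2)] continuous_attains_sup[OF assms(1) False assms(2)] by blast
  then show ?thesis using assms(3) by (intro exI[of _ "f a"]) auto
qed (auto intro: exI[of _ 1])

text \<open>Pairs at distance at least \<open>\<epsilon>\<close> form two compact sets, one on each
  side of the diagonal, where \<open>\<Lambda>\<close> attains its extrema. Multiplying by
  \<open>q - q'\<close> treats both signs at once.\<close>

lemma sign_respecting_bounds: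
  assumes "sign_respecting \<Lambda>" "0 < \<epsilon>"
  shows "\<exists>l>0. \<exists>u. \<forall>q\<in>{\<epsilon>..1-\<epsilon>}. \<forall>q'\<in>{\<epsilon>..1-\<epsilon>}. \<bar>q - q'\<bar> \<ge> \<epsilon> \<longrightarrow>
    \<bar>\<Lambda> q q'\<bar> \<le> u \<and> l * \<bar>q - q'\<bar> \<le> \<Lambda> q q' * (q - q')"
proof -
  define S1 where "S1 = ({\<epsilon>..1-\<epsilon>} \<times> {\<epsilon>..1-\<epsilon>}) \<inter> {z. \<epsilon> \<le> fst z - snd z}"
  define S2 where "S2 = ({\<epsilon>..1-\<epsilon>} \<times> {\<epsilon>..1-\<epsilon>}) \<inter> {z. \<epsilon> \<le> snd z - fst z}"
  have c: "compact S1" "compact S2" unfolding S1_def S2_def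
    by (intro compact_Int_closed compact_Times closed_Collect_le continuous_intros; simp)+
  have "\<exists>l>0. \<exists>u. \<forall>z\<in>S1. l \<le> (\<lambda>(q, q'). \<Lambda> q q') z \<and> (\<lambda>(q, q'). \<Lambda> q q') z \<le> u"
  proof (rule compact_pos_bounds[OF c(1)])
    show "continuous_on S1 (\<lambda>(q, q'). \<Lambda> q q')"
      by (rule continuous_on_subset[of "{(q, q'). q \<in> {0..1} \<and> q' \<in> {0..1} \<and> q > q'}"])
        (use assms in \<open>auto simp: sign_respecting_def S1_def\<close>)
  qed (use assms in \<open>auto simp: sign_respecting_def S1_def\<close>)
  moreover have "\<exists>l>0. \<exists>u. \<forall>z\<in>S2. l \<le> - (\<lambda>(q, q'). \<Lambda> q q') z \<and> - (\<lambda>(q, q'). \<Lambda> q q') z \<le> u"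
  proof (rule compact_pos_bounds[OF c(2)])
    show "continuous_on S2 (\<lambda>z. - (\<lambda>(q, q'). \<Lambda> q q') z)"
      by (rule continuous_on_minus, rule continuous_on_subset[of "{(q, q'). q \<in> {0..1} \<and> q' \<in> {0..1} \<and> q < q'}"])
        (use assms in \<open>auto simp: sign_respecting_def S2_def\<close>)
  qed (use assms in \<open>auto simp: sign_respecting_def S2_def\<close>)
  ultimately obtain l1 u1 l2 u2 where l: "l1 > 0" "l2 > 0"
    and 1: "\<And>q q'. (q, q') \<in> S1 \<Longrightarrow> l1 \<le> \<Lambda> q q' \<and> \<Lambda> q q' \<le> u1"
    and 2: "\<And>q q'. (q, q') \<in> S2 \<Longrightarrow> l2 \<le> - \<Lambda> q q' \<and> - \<Lambda> q q' \<le> u2"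
    by (metis (no_types, lifting) case_prod_conv)
  have "\<forall>q\<in>{\<epsilon>..1-\<epsilon>}. \<forall>q'\<in>{\<epsilon>..1-\<epsilon>}. \<bar>q - q'\<bar> \<ge> \<epsilon> \<longrightarrow>
    \<bar>\<Lambda> q q'\<bar> \<le> max u1 u2 \<and> min l1 l2 * \<bar>q - q'\<bar> \<le> \<Lambda> q q' * (q - q')"
  proof (intro ballI impI)
    fix q q' assume q: "q \<in> {\<epsilon>..1-\<epsilon>}" "q' \<in> {\<epsilon>..1-\<epsilon>}" "\<epsilon> \<le> \<bar>q - q'\<bar>"
    then consider "(q, q') \<in> S1" "q > q'" | "(q, q') \<in> S2" "q < q'" 
      using assms by (auto simp: S1_def S2_def abs_if split: if_splits)
    then show "\<bar>\<Lambda> q q'\<bar> \<le> max u1 u2 \<and> min l1 l2 * \<bar>q - q'\<bar> \<le> \<Lambda> q q' * (q - q')"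
    proof cases
      case 1
      then show ?thesis using \<open>\<And>q q'. (q, q') \<in> S1 \<Longrightarrow> l1 \<le> \<Lambda> q q' \<and> \<Lambda> q q' \<le> u1\<close>[of q q'] l
        by (auto intro!: mult_right_mono)
    next
      case 2
      have "min l1 l2 * (q' - q) \<le> - \<Lambda> q q' * (q' - q)"
        using 2 \<open>\<And>q q'. (q, q') \<in> S2 \<Longrightarrow> l2 \<le> - \<Lambda> q q' \<and> - \<Lambda> q q' \<le> u2\<close>[of q q'] by (intro mult_right_mono) auto
      then show ?thesis using 2 \<open>\<And>q q'. (q, q') \<in> S2 \<Longrightarrow> l2 \<le> - \<Lambda> q q' \<and> - \<Lambda> q q' \<le> u2\<close>[of q q'] l
        by (auto simp: algebra_simps)
    qed
  qed
  moreover have "min l1 l2 > 0" using l by simp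
  ultimately show ?thesis by blast
qed

text \<open>The estimates for one class, from \<open>tail_ratio\<close> with \<open>slope\<close>
  and \<open>\<Lambda>\<close> as the two coefficient vectors. The constants do not depend on
  \<open>p\<close> and \<open>p'\<close>, so the same ones apply after exchanging them.\<close>

lemma one_sided_tail:
  fixes \<epsilon> :: real
  assumes \<Lambda>: "sign_respecting \<Lambda>" and \<epsilon>: "0 < \<epsilon>" "\<epsilon> < 1/2"
  shows "\<exists>K0>0. \<exists>M>0. \<exists>v>0. \<forall>K1\<ge>K0. \<exists>N. \<forall>n\<ge>N. \<forall>p p'.
    (\<forall>i\<in>{1..n}. p i \<in> {\<epsilon>..1-\<epsilon>} \<and> p' i \<in> {\<epsilon>..1-\<epsilon>} \<and> \<bar>p i - p' i\<bar> \<ge> \<epsilon>) \<longrightarrow>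
      bprob n p (\<lambda>x. \<bar>score n p p' x\<bar> < sep n p p' - K1 * sqrt n) \<le> M\<^sup>2 / K1\<^sup>2 \<and>
      (\<forall>K\<in>{K0..K1}.
        3/4 * exp (- 1 - (K + 9 * M)\<^sup>2 / v) \<le> bprob n p (\<lambda>x. \<bar>score n p p' x\<bar> \<le> sep n p p' - K * sqrt n) \<and>
        bprob n p (\<lambda>x. \<bar>score n p p' x\<bar> \<le> sep n p p' - K * sqrt n \<and>
            \<not> cdfB n p (Psi \<Lambda> n p p') (Psi \<Lambda> n p p' x) \<le> \<epsilon>) \<le>
          \<epsilon> * bprob n p (\<lambda>x. \<bar>score n p p' x\<bar> \<le> sep n p p' - K * sqrt n))"
proof -
  obtain l u where l: "l > 0" and lu: "\<And>q q'. q \<in> {\<epsilon>..1-\<epsilon>} \<Longrightarrow> q' \<in> {\<epsilon>..1-\<epsilon>} \<Longrightarrow> \<bar>q - q'\<bar> \<ge> \<epsilon> \<Longrightarrow>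
    \<bar>\<Lambda> q q'\<bar> \<le> u \<and> l * \<bar>q - q'\<bar> \<le> \<Lambda> q q' * (q - q')"
    using sign_respecting_bounds[OF \<Lambda> \<epsilon>(1)] by blast
  \<comment> \<open>\<open>w\<close> bounds the coordinate variances from below and \<open>M\<close>
    bounds both coefficient vectors. \<open>m\<close> bounds from below the squared slopes and their
    products with the \<open>\<Lambda>\<close> coefficients. \<open>K'\<close> makes the Chebyshev
    bound for the cue score equal to \<open>\<epsilon>\<close>.\<close>
  define w where "w = 4 * \<epsilon> * (1 - \<epsilon>)"
  define m where "m = min (\<epsilon>\<^sup>2) (l * \<epsilon>)"
  define M where "M = max (1 / w) u"
  define K' where "K' = M / sqrt \<epsilon>"
  have pos: "w > 0" "m > 0" "M > 0" "K' > 0" using \<epsilon> l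
    by (auto simp: w_def m_def M_def K'_def less_max_iff_disj)
  obtain K0 where K0: "K0 > 0" and tail: "\<And>K1. K1 \<ge> K0 \<Longrightarrow> \<exists>N. \<forall>n\<ge>N. \<forall>q a c K.
    (\<forall>i\<in>{1..n}. 0 \<le> q i \<and> q i \<le> 1 \<and> w \<le> 4 * q i * (1 - q i) \<and> m \<le> a i * a i \<and> \<bar>a i\<bar> \<le> M
        \<and> \<bar>c i\<bar> \<le> M \<and> m \<le> a i * c i) \<and> K0 \<le> K \<and> K \<le> K1 \<longrightarrow>
    3/4 * exp (- 1 - (K + 9 * M)\<^sup>2 / (2 * (m * w))) \<le>
      bprob n q (\<lambda>x. - (K + 6 * M) * sqrt n \<le> centered_sum n q a x \<and> centered_sum n q a x \<le> - K * sqrt n) \<and>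
    bprob n q (\<lambda>x. centered_sum n q a x \<le> - K * sqrt n \<and> - K' * sqrt n \<le> centered_sum n q c x) \<le>
      \<epsilon> * bprob n q (\<lambda>x. - (K + 6 * M) * sqrt n \<le> centered_sum n q a x \<and> centered_sum n q a x \<le> - K * sqrt n)"
    using tail_ratio[OF pos(3) pos(2) pos(1) \<epsilon>(1) pos(4)] by blast
  have "\<exists>N. \<forall>n\<ge>N. \<forall>p p'.
    (\<forall>i\<in>{1..n}. p i \<in> {\<epsilon>..1-\<epsilon>} \<and> p' i \<in> {\<epsilon>..1-\<epsilon>} \<and> \<bar>p i - p' i\<bar> \<ge> \<epsilon>) \<longrightarrow>
      bprob n p (\<lambda>x. \<bar>score n p p' x\<bar> < sep n p p' - K1 * sqrt n) \<le> M\<^sup>2 / K1\<^sup>2 \<and>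
      (\<forall>K\<in>{K0..K1}.
        3/4 * exp (- 1 - (K + 9 * M)\<^sup>2 / (2 * (m * w))) \<le> bprob n p (\<lambda>x. \<bar>score n p p' x\<bar> \<le> sep n p p' - K * sqrt n) \<and>
        bprob n p (\<lambda>x. \<bar>score n p p' x\<bar> \<le> sep n p p' - K * sqrt n \<and>
            \<not> cdfB n p (Psi \<Lambda> n p p') (Psi \<Lambda> n p p' x) \<le> \<epsilon>) \<le>
          \<epsilon> * bprob n p (\<lambda>x. \<bar>score n p p' x\<bar> \<le> sep n p p' - K * sqrt n))" if K1: "K1 \<ge> K0" for K1
  proof -
    obtain N0 where N0: "\<And>n q a c K. n \<ge> N0 \<Longrightarrow> 
    (\<forall>i\<in>{1..n}. 0 \<le> q i \<and> q i \<le> 1 \<and> w \<le> 4 * q i * (1 - q i) \<and> m \<le> a i * a i \<and> \<bar>a i\<bar> \<le> M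
        \<and> \<bar>c i\<bar> \<le> M \<and> m \<le> a i * c i) \<and> K0 \<le> K \<and> K \<le> K1 \<Longrightarrow>
    3/4 * exp (- 1 - (K + 9 * M)\<^sup>2 / (2 * (m * w))) \<le>
      bprob n q (\<lambda>x. - (K + 6 * M) * sqrt n \<le> centered_sum n q a x \<and> centered_sum n q a x \<le> - K * sqrt n) \<and>
    bprob n q (\<lambda>x. centered_sum n q a x \<le> - K * sqrt n \<and> - K' * sqrt n \<le> centered_sum n q c x) \<le>
      \<epsilon> * bprob n q (\<lambda>x. - (K + 6 * M) * sqrt n \<le> centered_sum n q a x \<and> centered_sum n q a x \<le> - K * sqrt n)"
      using tail[OF K1] by blast
    \<comment> \<open>For such \<open>n\<close> the separation, at least
      \<open>n * \<epsilon>\<^sup>2\<close>, exceeds \<open>(K1 + 3 * M) * sqrt n\<close>.\<close>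
    define R where "R = (K1 + 3 * M) / \<epsilon>\<^sup>2"
    define N where "N = max N0 (nat \<lceil>R\<^sup>2\<rceil> + 1)"
    show ?thesis
    proof (intro exI[of _ N] allI impI)
      fix n p p'
      assume n: "n \<ge> N"
        and hyp: "\<forall>i\<in>{1..n}. p i \<in> {\<epsilon>..1-\<epsilon>} \<and> p' i \<in> {\<epsilon>..1-\<epsilon>} \<and> \<bar>p i - p' i\<bar> \<ge> \<epsilon>"
      have n0: "n > 0" using n by (simp add: N_def)
      have sn: "sqrt n > 0" and snn: "sqrt n * sqrt n = n" using n0 by auto
      have "R\<^sup>2 \<le> n" using n unfolding N_def by linarith
      then have "R \<le> sqrt n" by (rule real_le_rsqrt)
      then have R: "K1 + 3 * M \<le> \<epsilon>\<^sup>2 * sqrt n" using \<epsilon> by (simp add: R_def field_simps)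
      have p: "0 \<le> p i \<and> p i \<le> 1" if "i \<in> {1..n}" for i
      proof -
        have "p i \<in> {\<epsilon>..1-\<epsilon>}" using hyp that by blast
        then show ?thesis using \<epsilon> by simp
      qed
      define a where "a = slope p p'"
      define c where "c = (\<lambda>i. \<Lambda> (p i) (p' i))"
      have var: "w \<le> 4 * q * (1 - q)" if "q \<in> {\<epsilon>..1-\<epsilon>}" for q
      proof -
        have "0 \<le> (q - \<epsilon>) * (1 - \<epsilon> - q)" using that by simp
        then show ?thesis unfolding w_def by (simp add: algebra_simps)
      qed
      have coeff: "m \<le> a i * a i \<and> \<bar>a i\<bar> \<le> M \<and> \<bar>c i\<bar> \<le> M \<and> m \<le> a i * c i \<and> \<epsilon>\<^sup>2 \<le> a i * (p i - p' i)"
        if i: "i \<in> {1..n}" for i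
      proof -
        define v where "v = 2 * p i * (1 - p i) + 2 * p' i * (1 - p' i)"
        define d where "d = p i - p' i"
        have pi: "p i \<in> {\<epsilon>..1-\<epsilon>}" "p' i \<in> {\<epsilon>..1-\<epsilon>}" "\<bar>d\<bar> \<ge> \<epsilon>" using hyp i by (auto simp: d_def)
        have v: "w \<le> v" "v \<le> 1" using var[OF pi(1)] var[OF pi(2)] var_le_1[of "p i"] var_le_1[of "p' i"]
          unfolding v_def by linarith+
        have vp: "v > 0" using v pos by linarith
        have ai: "a i = d / v" by (simp add: a_def slope_def d_def v_def)
        have d1: "\<bar>d\<bar> \<le> 1" using pi \<epsilon> by (auto simp: d_def)
        have "\<bar>d\<bar> * v \<le> \<bar>d\<bar> * 1" using v by (intro mult_left_mono) auto
        then have age: "\<bar>d\<bar> \<le> \<bar>a i\<bar>" unfolding ai using vp by (simp add: field_simps)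
        have ale: "\<bar>a i\<bar> \<le> 1 / w" unfolding ai abs_divide using d1 v pos vp by (intro frac_le) auto
        have "\<epsilon>\<^sup>2 \<le> \<bar>a i\<bar> * \<bar>a i\<bar>" unfolding power2_eq_square using age pi \<epsilon> by (intro mult_mono) auto
        then have 1: "\<epsilon>\<^sup>2 \<le> a i * a i" by simp
        have "\<epsilon>\<^sup>2 \<le> \<bar>a i\<bar> * \<bar>d\<bar>" unfolding power2_eq_square using age pi \<epsilon> by (intro mult_mono) auto
        also have "\<dots> = a i * d" unfolding ai using vp by (simp add: abs_mult_self_eq)
        finally have 2: "\<epsilon>\<^sup>2 \<le> a i * d" .
        have ci: "\<bar>c i\<bar> \<le> u" "l * \<bar>d\<bar> \<le> c i * d" using lu[OF pi(1,2)] pi(3) by (auto simp: c_def d_def)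
        have "l * \<epsilon> \<le> l * \<bar>d\<bar>" using l pi by (intro mult_left_mono) auto
        also have "\<dots> \<le> c i * d" by (rule ci)
        finally have 3: "l * \<epsilon> \<le> c i * d" .
        moreover have "0 \<le> l * \<epsilon>" using l \<epsilon> by simp
        ultimately have "c i * d * v \<le> c i * d * 1" using v by (intro mult_left_mono) auto
        then have "c i * d \<le> a i * c i" unfolding ai using vp by (simp add: field_simps)
        then show ?thesis using 1 2 3 ale ci by (auto simp: m_def M_def d_def)
      qed
      define W where "W = centered_sum n p a"
      define U where "U = centered_sum n p c"
      define S where "S = sep n p p'"
      have W: "W x = score n p p' x - S" for x
        by (simp add: W_def S_def a_def centered_sum_slope)
      have S: "n * \<epsilon>\<^sup>2 \<le> S"
      proof -
        have "(\<Sum>i\<in>{1..n}. \<epsilon>\<^sup>2) \<le> S" unfolding S_def sep_def using coeff by (intro sum_mono) (auto simp: a_def)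
        then show ?thesis by simp
      qed
      have "(K1 + 3 * M) * sqrt n \<le> \<epsilon>\<^sup>2 * sqrt n * sqrt n" using R sn by (intro mult_right_mono) auto
      also have "\<dots> = n * \<epsilon>\<^sup>2" using snn by (simp add: mult.assoc)
      finally have SK: "(K1 + 3 * M) * sqrt n \<le> S" using S by linarith
      have cheb: "bprob n p (\<lambda>x. \<bar>score n p p' x\<bar> < S - K1 * sqrt n) \<le> M\<^sup>2 / K1\<^sup>2"
      proof -
        have "bprob n p (\<lambda>x. \<bar>score n p p' x\<bar> < S - K1 * sqrt n) \<le> bprob n p (\<lambda>x. K1 * sqrt n \<le> \<bar>W x\<bar>)"
          by (rule bprob_mono[OF p]) (auto simp: W)
        also have "\<dots> \<le> M\<^sup>2 * real n / (K1 * sqrt n)\<^sup>2"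
          unfolding W_def using coeff K0 K1 sn by (intro chebyshev_centered_sum p) auto
        finally show ?thesis using n0 by (simp add: power_mult_distrib)
      qed
      \<comment> \<open>The cue score and \<open>U\<close> differ by a constant. If
        \<open>U x\<close> were below \<open>- K' * sqrt n\<close>, Chebyshev would bound the CDF at
        its score by \<open>\<epsilon>\<close>.\<close>
      have U: "- K' * sqrt n \<le> U x" if "\<not> cdfB n p (Psi \<Lambda> n p p') (Psi \<Lambda> n p p' x) \<le> \<epsilon>" for x
      proof (rule ccontr)
        assume neg: "\<not> - K' * sqrt n \<le> U x"
        have Psi: "Psi \<Lambda> n p p' y = U y + (\<Sum>i\<in>{1..n}. c i * (2 * p i - 1))" for y
          unfolding Psi_def U_def centered_sum_def sum.distrib[symmetric]
          by (intro sum.cong) (auto simp: c_def algebra_simps)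
        have "cdfB n p (Psi \<Lambda> n p p') (Psi \<Lambda> n p p' x) = bprob n p (\<lambda>y. U y \<le> U x)"
          by (simp add: cdfB_def bprob_def Psi)
        also have "\<dots> \<le> bprob n p (\<lambda>y. K' * sqrt n \<le> \<bar>U y\<bar>)"
          by (rule bprob_mono[OF p]) (use neg in auto)
        also have "\<dots> \<le> M\<^sup>2 * real n / (K' * sqrt n)\<^sup>2"
          unfolding U_def using coeff pos sn by (intro chebyshev_centered_sum p) auto
        also have "\<dots> = \<epsilon>" using n0 pos \<epsilon> by (simp add: power_mult_distrib K'_def power_divide)
        finally show False using that by simp
      qed
      have "3/4 * exp (- 1 - (K + 9 * M)\<^sup>2 / (2 * (m * w))) \<le> bprob n p (\<lambda>x. \<bar>score n p p' x\<bar> \<le> S - K * sqrt n) \<and>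
        bprob n p (\<lambda>x. \<bar>score n p p' x\<bar> \<le> S - K * sqrt n \<and>
            \<not> cdfB n p (Psi \<Lambda> n p p') (Psi \<Lambda> n p p' x) \<le> \<epsilon>) \<le>
          \<epsilon> * bprob n p (\<lambda>x. \<bar>score n p p' x\<bar> \<le> S - K * sqrt n)" if K: "K \<in> {K0..K1}" for K
      proof -
        have main: "3/4 * exp (- 1 - (K + 9 * M)\<^sup>2 / (2 * (m * w))) \<le>
            bprob n p (\<lambda>x. - (K + 6 * M) * sqrt n \<le> W x \<and> W x \<le> - K * sqrt n) \<and>
          bprob n p (\<lambda>x. W x \<le> - K * sqrt n \<and> - K' * sqrt n \<le> U x) \<le>
            \<epsilon> * bprob n p (\<lambda>x. - (K + 6 * M) * sqrt n \<le> W x \<and> W x \<le> - K * sqrt n)"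
          unfolding W_def U_def by (rule N0) (use n K p coeff hyp var in \<open>auto simp: N_def\<close>)
        have "K * sqrt n \<le> K1 * sqrt n" using K sn by (intro mult_right_mono) auto
        \<comment> \<open>This puts the lower end of the window above
          \<open>- (S - K * sqrt n)\<close>, so the two-sided event on the score contains the whole
          window.\<close>
        then have KS: "2 * (K * sqrt n) + 6 * (M * sqrt n) \<le> 2 * S" using SK by (simp add: algebra_simps)
        have 1: "bprob n p (\<lambda>x. - (K + 6 * M) * sqrt n \<le> W x \<and> W x \<le> - K * sqrt n)
            \<le> bprob n p (\<lambda>x. \<bar>score n p p' x\<bar> \<le> S - K * sqrt n)"
        proof (rule bprob_mono[OF p])
          fix x assume "- (K + 6 * M) * sqrt n \<le> W x \<and> W x \<le> - K * sqrt n"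
          then have "- (K * sqrt n) - 6 * (M * sqrt n) \<le> score n p p' x - S" "score n p p' x - S \<le> - (K * sqrt n)"
            unfolding W by (auto simp: algebra_simps)
          then show "\<bar>score n p p' x\<bar> \<le> S - K * sqrt n" using KS by linarith
        qed
        have 2: "bprob n p (\<lambda>x. \<bar>score n p p' x\<bar> \<le> S - K * sqrt n \<and>
            \<not> cdfB n p (Psi \<Lambda> n p p') (Psi \<Lambda> n p p' x) \<le> \<epsilon>)
            \<le> bprob n p (\<lambda>x. W x \<le> - K * sqrt n \<and> - K' * sqrt n \<le> U x)"
          by (rule bprob_mono[OF p]) (use U in \<open>auto simp: W\<close>)
        have "\<epsilon> * bprob n p (\<lambda>x. - (K + 6 * M) * sqrt n \<le> W x \<and> W x \<le> - K * sqrt n)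
            \<le> \<epsilon> * bprob n p (\<lambda>x. \<bar>score n p p' x\<bar> \<le> S - K * sqrt n)"
          using 1 \<epsilon> by (intro mult_left_mono) auto
        with 1 2 main show ?thesis by linarith
      qed
      with cheb show "bprob n p (\<lambda>x. \<bar>score n p p' x\<bar> < sep n p p' - K1 * sqrt n) \<le> M\<^sup>2 / K1\<^sup>2 \<and>
      (\<forall>K\<in>{K0..K1}.
        3/4 * exp (- 1 - (K + 9 * M)\<^sup>2 / (2 * (m * w))) \<le> bprob n p (\<lambda>x. \<bar>score n p p' x\<bar> \<le> sep n p p' - K * sqrt n) \<and>
        bprob n p (\<lambda>x. \<bar>score n p p' x\<bar> \<le> sep n p p' - K * sqrt n \<and>
            \<not> cdfB n p (Psi \<Lambda> n p p') (Psi \<Lambda> n p p' x) \<le> \<epsilon>) \<le>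
          \<epsilon> * bprob n p (\<lambda>x. \<bar>score n p p' x\<bar> \<le> sep n p p' - K * sqrt n))"
        unfolding S_def by blast
    qed
  qed
  moreover have "2 * (m * w) > 0" using pos by simp
  ultimately show ?thesis using K0 pos(3) by blast
qed

lemma bprob_cong:
  "(\<And>x. x \<in> cube n \<Longrightarrow> P x \<longleftrightarrow> Q x) \<Longrightarrow> bprob n q P = bprob n q Q"
  unfolding bprob_def by (intro sum.cong) auto

section \<open>Conditioning on high entropy, uniformly over both classes\<close>

theorem theorem1:
  fixes \<Lambda> :: "real \<Rightarrow> real \<Rightarrow> real" and \<epsilon> :: real
  assumes "sign_respecting \<Lambda>" and "0 < \<epsilon>" and "\<epsilon> < 1/2"
  shows "\<exists>\<delta>0 > 0. \<forall>\<delta>. 0 < \<delta> \<and> \<delta> \<le> \<delta>0 \<longrightarrow>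
    (\<exists>N::nat. \<forall>n \<ge> N. \<forall>\<eta> p p' \<beta>.
       0 \<le> \<eta> \<and> \<eta> < 1/2 \<and>
       (\<forall>i\<in>{1..n}. p i \<in> {\<epsilon>..1-\<epsilon>} \<and> p' i \<in> {\<epsilon>..1-\<epsilon>} \<and> \<bar>p i - p' i\<bar> \<ge> \<epsilon>) \<and>
       is_risk_minimizer n \<eta> p p' \<beta> \<longrightarrow>
       probD n \<eta> p p' (\<lambda>x y z. Rscore \<Lambda> n p p' x z \<le> \<epsilon> \<and>
                                 cdfH n \<eta> p p' \<beta> (Hbeta n \<beta> x) \<ge> 1 - \<delta>)
       / probD n \<eta> p p' (\<lambda>x y z. cdfH n \<eta> p p' \<beta> (Hbeta n \<beta> x) \<ge> 1 - \<delta>)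
       \<ge> 1 - \<epsilon>)"
proof -
  obtain K0 M v where K0: "K0 > 0" and M: "M > 0" and v: "v > 0" and tail: "\<And>K1. K1 \<ge> K0 \<Longrightarrow> \<exists>N. \<forall>n\<ge>N. \<forall>p p'.
    (\<forall>i\<in>{1..n}. p i \<in> {\<epsilon>..1-\<epsilon>} \<and> p' i \<in> {\<epsilon>..1-\<epsilon>} \<and> \<bar>p i - p' i\<bar> \<ge> \<epsilon>) \<longrightarrow>
      bprob n p (\<lambda>x. \<bar>score n p p' x\<bar> < sep n p p' - K1 * sqrt n) \<le> M\<^sup>2 / K1\<^sup>2 \<and>
      (\<forall>K\<in>{K0..K1}.
        3/4 * exp (- 1 - (K + 9 * M)\<^sup>2 / v) \<le> bprob n p (\<lambda>x. \<bar>score n p p' x\<bar> \<le> sep n p p' - K * sqrt n) \<and>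
        bprob n p (\<lambda>x. \<bar>score n p p' x\<bar> \<le> sep n p p' - K * sqrt n \<and>
            \<not> cdfB n p (Psi \<Lambda> n p p') (Psi \<Lambda> n p p' x) \<le> \<epsilon>) \<le>
          \<epsilon> * bprob n p (\<lambda>x. \<bar>score n p p' x\<bar> \<le> sep n p p' - K * sqrt n))"
    using one_sided_tail[OF assms] by blast
  \<comment> \<open>Half of the lower bound at \<open>K0\<close> for the probability of a small
    score, so that the high-entropy threshold cannot lie above
    \<open>S - K0 * sqrt n\<close>.\<close>
  define \<delta>0 where "\<delta>0 = 3/8 * exp (- 1 - (K0 + 9 * M)\<^sup>2 / v)"
  have "\<delta>0 > 0" by (simp add: \<delta>0_def)
  moreover have "\<exists>N::nat. \<forall>n \<ge> N. \<forall>\<eta> p p' \<beta>.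
       0 \<le> \<eta> \<and> \<eta> < 1/2 \<and>
       (\<forall>i\<in>{1..n}. p i \<in> {\<epsilon>..1-\<epsilon>} \<and> p' i \<in> {\<epsilon>..1-\<epsilon>} \<and> \<bar>p i - p' i\<bar> \<ge> \<epsilon>) \<and>
       is_risk_minimizer n \<eta> p p' \<beta> \<longrightarrow>
       probD n \<eta> p p' (\<lambda>x y z. Rscore \<Lambda> n p p' x z \<le> \<epsilon> \<and>
                                 cdfH n \<eta> p p' \<beta> (Hbeta n \<beta> x) \<ge> 1 - \<delta>)
       / probD n \<eta> p p' (\<lambda>x y z. cdfH n \<eta> p p' \<beta> (Hbeta n \<beta> x) \<ge> 1 - \<delta>)
       \<ge> 1 - \<epsilon>" if \<delta>: "0 < \<delta>" "\<delta> \<le> \<delta>0" for \<delta>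
  proof -
    \<comment> \<open>Makes \<open>M\<^sup>2 / K1\<^sup>2\<close> at most \<open>\<delta>\<close>,
      so that the threshold can be taken no lower than \<open>S - K1 * sqrt n\<close>. It depends on
      \<open>\<delta>\<close> but not on \<open>n\<close>.\<close>
    define K1 where "K1 = max K0 (M / sqrt \<delta>)"
    have K1: "K1 \<ge> K0" "K1 > 0" using K0 by (auto simp: K1_def)
    obtain N where N: "\<And>n p p'. n \<ge> N \<Longrightarrow>
      (\<forall>i\<in>{1..n}. p i \<in> {\<epsilon>..1-\<epsilon>} \<and> p' i \<in> {\<epsilon>..1-\<epsilon>} \<and> \<bar>p i - p' i\<bar> \<ge> \<epsilon>) \<Longrightarrow>
      bprob n p (\<lambda>x. \<bar>score n p p' x\<bar> < sep n p p' - K1 * sqrt n) \<le> M\<^sup>2 / K1\<^sup>2 \<and>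
      (\<forall>K\<in>{K0..K1}.
        3/4 * exp (- 1 - (K + 9 * M)\<^sup>2 / v) \<le> bprob n p (\<lambda>x. \<bar>score n p p' x\<bar> \<le> sep n p p' - K * sqrt n) \<and>
        bprob n p (\<lambda>x. \<bar>score n p p' x\<bar> \<le> sep n p p' - K * sqrt n \<and>
            \<not> cdfB n p (Psi \<Lambda> n p p') (Psi \<Lambda> n p p' x) \<le> \<epsilon>) \<le>
          \<epsilon> * bprob n p (\<lambda>x. \<bar>score n p p' x\<bar> \<le> sep n p p' - K * sqrt n))"
      using tail[OF K1(1)] by blast
    show ?thesis
    proof (intro exI[of _ "max N 1"] allI impI)
      fix n \<eta> p p' \<beta>
      assume n: "max N 1 \<le> n" and hyp: "0 \<le> \<eta> \<and> \<eta> < 1/2 \<and>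
       (\<forall>i\<in>{1..n}. p i \<in> {\<epsilon>..1-\<epsilon>} \<and> p' i \<in> {\<epsilon>..1-\<epsilon>} \<and> \<bar>p i - p' i\<bar> \<ge> \<epsilon>) \<and>
       is_risk_minimizer n \<eta> p p' \<beta>"
      have sn: "sqrt n > 0" using n by simp
      have pp: "\<forall>i\<in>{1..n}. p i \<in> {\<epsilon>..1-\<epsilon>} \<and> p' i \<in> {\<epsilon>..1-\<epsilon>} \<and> \<bar>p i - p' i\<bar> \<ge> \<epsilon>"
        "\<forall>i\<in>{1..n}. p' i \<in> {\<epsilon>..1-\<epsilon>} \<and> p i \<in> {\<epsilon>..1-\<epsilon>} \<and> \<bar>p' i - p i\<bar> \<ge> \<epsilon>"
        using hyp by (auto simp: abs_minus_commute)
      have pin: "0 < p i \<and> p i < 1" "0 < p' i \<and> p' i < 1" if "i \<in> {1..n}" for i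
      proof -
        have "p i \<in> {\<epsilon>..1-\<epsilon>}" "p' i \<in> {\<epsilon>..1-\<epsilon>}" using hyp that by blast+
        then show "0 < p i \<and> p i < 1" "0 < p' i \<and> p' i < 1" using assms by auto
      qed
      have p01: "\<And>i. i \<in> {1..n} \<Longrightarrow> 0 \<le> p i \<and> p i \<le> 1" "\<And>i. i \<in> {1..n} \<Longrightarrow> 0 \<le> p' i \<and> p' i \<le> 1"
        using pin by (auto simp: less_imp_le)
      define T where "T = score n p p'"
      define S where "S = sep n p p'"
      have absT: "\<bar>score n p' p x\<bar> = \<bar>T x\<bar>" for x by (simp add: T_def score_swap[of n p' p])
      define G where "G = (\<lambda>q t. bprob n q (\<lambda>x. \<bar>T x\<bar> \<le> t))"
      \<comment> \<open>The probability of strictly larger entropy, hence the strict inequality; the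
        CDF of the entropy is \<open>1 - L\<close>, evaluated at the absolute score.\<close>
      define L where "L = (\<lambda>u. 1/2 * bprob n p (\<lambda>x. \<bar>T x\<bar> < u) + 1/2 * bprob n p' (\<lambda>x. \<bar>T x\<bar> < u))"
      have L_mono: "L u \<le> L u'" if "u \<le> u'" for u u'
        unfolding L_def using that by (intro add_mono mult_left_mono bprob_mono p01) auto
      have Np: "bprob n p (\<lambda>x. \<bar>T x\<bar> < S - K1 * sqrt n) \<le> M\<^sup>2 / K1\<^sup>2"
        "\<And>K. K0 \<le> K \<Longrightarrow> K \<le> K1 \<Longrightarrow> 3/4 * exp (- 1 - (K + 9 * M)\<^sup>2 / v) \<le> G p (S - K * sqrt n) \<and>
          bprob n p (\<lambda>x. \<bar>T x\<bar> \<le> S - K * sqrt n \<and> \<not> cdfB n p (Psi \<Lambda> n p p') (Psi \<Lambda> n p p' x) \<le> \<epsilon>) \<le>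
          \<epsilon> * G p (S - K * sqrt n)"
        using N[OF _ pp(1)] n unfolding G_def T_def S_def by auto
      have Np': "bprob n p' (\<lambda>x. \<bar>T x\<bar> < S - K1 * sqrt n) \<le> M\<^sup>2 / K1\<^sup>2"
        "\<And>K. K0 \<le> K \<Longrightarrow> K \<le> K1 \<Longrightarrow> 3/4 * exp (- 1 - (K + 9 * M)\<^sup>2 / v) \<le> G p' (S - K * sqrt n) \<and>
          bprob n p' (\<lambda>x. \<bar>T x\<bar> \<le> S - K * sqrt n \<and> \<not> cdfB n p' (Psi \<Lambda> n p' p) (Psi \<Lambda> n p' p x) \<le> \<epsilon>) \<le>
          \<epsilon> * G p' (S - K * sqrt n)"
        using N[OF _ pp(2)] n unfolding G_def S_def absT sep_swap[of n p' p] by auto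
      obtain c where c: "c > 0" and lin: "\<And>x. \<beta> 0 + (\<Sum>i\<in>{1..n}. \<beta> i * x i) = c * T x"
        using risk_minimizer_score[of n \<eta> p p' \<beta>] hyp pin unfolding T_def by blast
      have H_le: "Hbeta n \<beta> x' \<le> Hbeta n \<beta> x \<longleftrightarrow> \<not> \<bar>T x'\<bar> < \<bar>T x\<bar>" for x x'
        unfolding Hbeta_def Let_def lin Hbin_logistic_le_iff using c by (simp add: abs_mult not_less)
      have cdfH: "cdfH n \<eta> p p' \<beta> (Hbeta n \<beta> x) = 1 - L \<bar>T x\<bar>" for x
        unfolding cdfH_def H_le probD_eq bprob_not L_def by (simp add: field_simps)
      define u1 where "u1 = S - K1 * sqrt n"
      have "M\<^sup>2 / K1\<^sup>2 \<le> \<delta>"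
      proof -
        have "M / sqrt \<delta> \<le> K1" by (simp add: K1_def)
        then have "(M / sqrt \<delta>)\<^sup>2 \<le> K1\<^sup>2" using M \<delta> by (intro power_mono) auto
        then show ?thesis using \<delta> K1 by (simp add: power_divide field_simps)
      qed
      then have Lu1: "L u1 \<le> \<delta>" using Np(1) Np'(1) unfolding L_def u1_def by linarith
      \<comment> \<open>Beyond this level each class gives the event mass at least
        \<open>2 * \<delta>0\<close>, more than \<open>\<delta>\<close>.\<close>
      have Lle: "u \<le> S - K0 * sqrt n" if "L u \<le> \<delta>" for u
      proof (rule ccontr)
        assume "\<not> u \<le> S - K0 * sqrt n"
        then have "G p (S - K0 * sqrt n) \<le> bprob n p (\<lambda>x. \<bar>T x\<bar> < u)"
          "G p' (S - K0 * sqrt n) \<le> bprob n p' (\<lambda>x. \<bar>T x\<bar> < u)"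
          unfolding G_def by (auto intro!: bprob_mono p01)
        moreover have "2 * \<delta>0 \<le> G p (S - K0 * sqrt n)" "2 * \<delta>0 \<le> G p' (S - K0 * sqrt n)"
          using Np(2)[of K0] Np'(2)[of K0] K1 unfolding \<delta>0_def by auto
        ultimately have "2 * \<delta>0 \<le> L u" unfolding L_def by linarith
        then show False using that \<delta> \<open>\<delta>0 > 0\<close> by linarith
      qed
      \<comment> \<open>Inserting \<open>u1\<close> keeps \<open>t\<close> within \<open>K1 \<surd>n\<close> of \<open>S\<close> without changing the event.\<close>
      define X where "X = insert u1 ((\<lambda>x. \<bar>T x\<bar>) ` {x \<in> cube n. L \<bar>T x\<bar> \<le> \<delta>})"
      define t where "t = Max X"
      have X: "finite X" "X \<noteq> {}" by (auto simp: X_def)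
      have tX: "t \<in> X" unfolding t_def using X by (rule Max_in)
      then have Lt: "L t \<le> \<delta>" using Lu1 by (auto simp: X_def)
      have tu1: "u1 \<le> t" unfolding t_def using X by (intro Max_ge) (auto simp: X_def)
      define A where "A = (\<lambda>x. 1 - \<delta> \<le> cdfH n \<eta> p p' \<beta> (Hbeta n \<beta> x))"
      \<comment> \<open>\<open>t\<close> is at least every attained absolute score with
        \<open>L\<close> at most \<open>\<delta>\<close>; since \<open>L\<close> is monotone and
        \<open>L t\<close> is at most \<open>\<delta>\<close>, conditioning on high entropy is
        conditioning on \<open>\<bar>T x\<bar> \<le> t\<close>.\<close>
      have event: "A x \<longleftrightarrow> \<bar>T x\<bar> \<le> t" if "x \<in> cube n" for x
      proof -
        have "L \<bar>T x\<bar> \<le> \<delta> \<Longrightarrow> \<bar>T x\<bar> \<le> t" unfolding t_def using X that by (intro Max_ge) (auto simp: X_def)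
        moreover have "\<bar>T x\<bar> \<le> t \<Longrightarrow> L \<bar>T x\<bar> \<le> \<delta>" using L_mono Lt order_trans by blast
        ultimately show ?thesis unfolding A_def cdfH by auto
      qed
      define K where "K = (S - t) / sqrt n"
      have tK: "t = S - K * sqrt n" using sn by (simp add: K_def)
      have "K0 * sqrt n \<le> K * sqrt n" "K * sqrt n \<le> K1 * sqrt n"
        using Lle[OF Lt] tu1 unfolding u1_def tK by auto
      then have K: "K0 \<le> K" "K \<le> K1" using sn by simp_all
      define den where "den = probD n \<eta> p p' (\<lambda>x y z. A x)"
      have den: "den = 1/2 * G p t + 1/2 * G p' t"
        unfolding den_def probD_eq[of n \<eta> p p' "\<lambda>x z. A x"] G_def using event by (simp cong: bprob_cong)
      define num where "num = probD n \<eta> p p' (\<lambda>x y z. Rscore \<Lambda> n p p' x z \<le> \<epsilon> \<and> A x)"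
      define Rp Rp' where "Rp = (\<lambda>x. cdfB n p (Psi \<Lambda> n p p') (Psi \<Lambda> n p p' x) \<le> \<epsilon>)"
        and "Rp' = (\<lambda>x. cdfB n p' (Psi \<Lambda> n p' p) (Psi \<Lambda> n p' p x) \<le> \<epsilon>)"
      have num: "num = 1/2 * bprob n p (\<lambda>x. \<bar>T x\<bar> \<le> t \<and> Rp x) + 1/2 * bprob n p' (\<lambda>x. \<bar>T x\<bar> \<le> t \<and> Rp' x)"
        unfolding num_def probD_eq[of n \<eta> p p' "\<lambda>x z. Rscore \<Lambda> n p p' x z \<le> \<epsilon> \<and> A x"]
        using event by (simp add: Rscore_def Rp_def Rp'_def conj_commute cong: bprob_cong)
      have "3/4 * exp (- 1 - (K + 9 * M)\<^sup>2 / v) > 0" by simp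
      then have Gpos: "G p t > 0" "G p' t > 0" using Np(2)[OF K] Np'(2)[OF K] unfolding tK by linarith+
      \<comment> \<open>Removing the bad part leaves the fraction \<open>1 - \<epsilon>\<close> in
        each class separately; the average over both classes then keeps it.\<close>
      have "bprob n p (\<lambda>x. \<bar>T x\<bar> \<le> t \<and> Rp x) \<ge> (1 - \<epsilon>) * G p t"
        using Np(2)[OF K] bprob_split[of n p "\<lambda>x. \<bar>T x\<bar> \<le> t" Rp]
        unfolding G_def Rp_def tK by (simp add: algebra_simps)
      moreover have "bprob n p' (\<lambda>x. \<bar>T x\<bar> \<le> t \<and> Rp' x) \<ge> (1 - \<epsilon>) * G p' t"
        using Np'(2)[OF K] bprob_split[of n p' "\<lambda>x. \<bar>T x\<bar> \<le> t" Rp']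
        unfolding G_def Rp'_def tK by (simp add: algebra_simps)
      ultimately have "(1 - \<epsilon>) * den \<le> num" unfolding num den by (simp add: field_simps)
      moreover have "den > 0" using Gpos unfolding den by simp
      ultimately have "1 - \<epsilon> \<le> num / den" by (simp add: field_simps)
      then show "1 - \<epsilon> \<le> probD n \<eta> p p' (\<lambda>x y z. Rscore \<Lambda> n p p' x z \<le> \<epsilon> \<and>
                                 cdfH n \<eta> p p' \<beta> (Hbeta n \<beta> x) \<ge> 1 - \<delta>)
       / probD n \<eta> p p' (\<lambda>x y z. cdfH n \<eta> p p' \<beta> (Hbeta n \<beta> x) \<ge> 1 - \<delta>)"
        unfolding num_def den_def A_def .
    qed
  qed
  ultimately show ?thesis by blast
qed

end
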